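(* Let $n\geq 3$ and let $R$ be the Kazhdan-Lusztig semiring of the dihedral group $D_{2\cdot n}$, i.e. the $\mathbb{Z}_{\geq 0}$-subsemiring of $\mathbb{Z}[D_{2\cdot n}]$ generated by the Kazhdan-Lusztig basis elements $\underline{w}$, $w\in D_{2\cdot n}$. Then, up to isomorphism, the $R$-semimodules $C_{\{\underline{e}\}}$, $C_{\{\underline{w_0}\}}$, $\tilde{C}_{\mathcal{L}_s}$, $N_1$, $N_2$ and $N_3$ (defined in the context) are the only minimal proper $R$-semimodules.
   Context: A semiring is a tuple $(R,+,\cdot,0,1)$ where $(R,+,0)$ is a commutative monoid, $(R,\cdot,1)$ is a monoid, multiplication distributes over addition on both sides, and $0a=a0=0$ for all $a\in R$. A (left) $R$-semimodule is a commutative monoid $(M,+,0_M)$ with a map $R\times M\to M$, $(r,m)\mapsto r(m)$, such that $r(m+n)=r(m)+r(n)$, $r(0_M)=0_M$, $(r+s)(m)=r(m)+s(m)$, $(rs)(m)=r(s(m))$, $0(m)=0_M$, $1(m)=m$. It is called an $R$-module if $M$ is an abelian group, and a proper semimodule if it is not a module. A subsemimodule is a submonoid closed under the action of $R$. A non-zero $R$-semimodule $M$ is called minimal if its only subsemimodules are $\{0_M\}$ and $M$. Quotients of $M$ are taken with respect to $R$-congruences, i.e. equivalence relations $\sim$ such that $m\sim n$ implies $m+k\sim n+k$ for all $k\in M$ and $r(m)\sim r(n)$ for all $r\in R$. $D_{2\cdot n}=\langle s,t: s^2=t^2=(st)^n=(ts)^n=e\rangle$ is the dihedral group with $2n$ elements,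 with longest element $w_0=stst\cdots=tsts\cdots$ ($n$ factors). Every $w\neq w_0$ has a unique reduced expression. Bruhat order: $x\preceq w$ iff $x=w$ or $x$ has strictly smaller length than $w$. The Kazhdan-Lusztig basis elements of $\mathbb{Z}[D_{2\cdot n}]$ are $\underline{w}:=\sum_{x\preceq w}x$; they form a $\mathbb{Z}_{\geq 0}$-basis of $R$. Let $\mathcal{R}_s$ (resp. $\mathcal{R}_t$) be the set of all $\underline{w}$ with $w\neq e,w_0$ whose reduced expression has $s$ (resp. $t$) as the leftmost letter. The semimodules (each $\underline{w}$ acts as described, extended additively to $R$): - $C_{\{\underline{e}\}}$: underlying monoid $\{0,1\}$ with $1+1=1$; $\underline{e}$ acts as the identity and $\underline{w}$ acts as zero for $w\neq e$. - $C_{\{\underline{w_0}\}}$: underlying monoid $\{0,1\}$ with $1+1=1$; every $\underline{w}$ acts as the identity. - $\tilde{C}_{\mathcal{L}_s}$: underlying monoid the set $2^{\{x,y\}}=\{0,x,y,x+y\}$ of subsets of $\{x,y\}$ under union (all elements idempotent, $0=\varnothing$); $\underline{w_0}\cdot x=0$, $\underline{w}\cdot x=y$ if $\underline{w}\in\mathcal{R}_t$, and $\underline{w}\cdot x=x$ otherwise; $\underline{w_0}\cdot y=0$, $\underline{w}\cdot y=x$ if $\underline{w}\in\mathcal{R}_s$, and $\underline{w}\cdot y=y$ otherwise. - $N_1$: the $3$-element quotient of $\tilde{C}_{\mathcal{L}_s}$ in which $x+y$ is identified with $x$. - $N_2$: the $3$-element quotient of $\tilde{C}_{\mathcal{L}_s}$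 in which $x+y$ is identified with $y$. - $N_3$: the $2$-element quotient of $\tilde{C}_{\mathcal{L}_s}$ in which $x+y$ is identified with both $x$ and $y$. *)

theory Defs
  imports "HOL-Algebra.Module"
begin

section \<open>Semimodules over a semiring\<close>

locale semimodule = R?: semiring R + M?: abelian_monoid M for R and M (structure) +
  assumes smult_closed [simp, intro]:
      "\<lbrakk>a \<in> carrier R; x \<in> carrier M\<rbrakk> \<Longrightarrow> a \<odot>\<^bsub>M\<^esub> x \<in> carrier M"
    and smult_r_distr:
      "\<lbrakk>a \<in> carrier R; x \<in> carrier M; y \<in> carrier M\<rbrakk> \<Longrightarrow>
        a \<odot>\<^bsub>M\<^esub> (x \<oplus>\<^bsub>M\<^esub> y) = a \<odot>\<^bsub>M\<^esub> x \<oplus>\<^bsub>M\<^esub> a \<odot>\<^bsub>M\<^esub> y"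
    and smult_r_null: "a \<in> carrier R \<Longrightarrow> a \<odot>\<^bsub>M\<^esub> \<zero>\<^bsub>M\<^esub> = \<zero>\<^bsub>M\<^esub>"
    and smult_l_distr:
      "\<lbrakk>a \<in> carrier R; b \<in> carrier R; x \<in> carrier M\<rbrakk> \<Longrightarrow>
        (a \<oplus>\<^bsub>R\<^esub> b) \<odot>\<^bsub>M\<^esub> x = a \<odot>\<^bsub>M\<^esub> x \<oplus>\<^bsub>M\<^esub> b \<odot>\<^bsub>M\<^esub> x"
    and smult_assoc:
      "\<lbrakk>a \<in> carrier R; b \<in> carrier R; x \<in> carrier M\<rbrakk> \<Longrightarrow>
        (a \<otimes>\<^bsub>R\<^esub> b) \<odot>\<^bsub>M\<^esub> x = a \<odot>\<^bsub>M\<^esub> (b \<odot>\<^bsub>M\<^esub> x)"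
    and smult_l_null: "x \<in> carrier M \<Longrightarrow> \<zero>\<^bsub>R\<^esub> \<odot>\<^bsub>M\<^esub> x = \<zero>\<^bsub>M\<^esub>"
    and smult_one: "x \<in> carrier M \<Longrightarrow> \<one>\<^bsub>R\<^esub> \<odot>\<^bsub>M\<^esub> x = x"

definition proper_semimodule :: "('a, 'c) ring_scheme \<Rightarrow> ('a, 'b, 'd) module_scheme \<Rightarrow> bool" where
  "proper_semimodule R M \<longleftrightarrow> semimodule R M \<and> \<not> abelian_group M"

definition subsemimodule ::
    "'b set \<Rightarrow> ('a, 'c) ring_scheme \<Rightarrow> ('a, 'b, 'd) module_scheme \<Rightarrow> bool" where
  "subsemimodule H R M \<longleftrightarrow> submonoid H (add_monoid M) \<and>
     (\<forall>a\<in>carrier R. \<forall>x\<in>H. a \<odot>\<^bsub>M\<^esub> x \<in> H)"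

definition minimal_semimodule :: "('a, 'c) ring_scheme \<Rightarrow> ('a, 'b, 'd) module_scheme \<Rightarrow> bool" where
  "minimal_semimodule R M \<longleftrightarrow> semimodule R M \<and> carrier M \<noteq> {\<zero>\<^bsub>M\<^esub>} \<and>
     (\<forall>H. subsemimodule H R M \<longrightarrow> H = {\<zero>\<^bsub>M\<^esub>} \<or> H = carrier M)"

definition minimal_proper_semimodule ::
    "('a, 'c) ring_scheme \<Rightarrow> ('a, 'b, 'd) module_scheme \<Rightarrow> bool" where
  "minimal_proper_semimodule R M \<longleftrightarrow> minimal_semimodule R M \<and> proper_semimodule R M"

definition semimodule_iso ::
    "('a, 'c) ring_scheme \<Rightarrow> ('a, 'b, 'd) module_scheme \<Rightarrow> ('a, 'e, 'f) module_scheme \<Rightarrow> ('b \<Rightarrow> 'e) set"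
  where
  "semimodule_iso R M N = {h. bij_betw h (carrier M) (carrier N) \<and>
     h \<zero>\<^bsub>M\<^esub> = \<zero>\<^bsub>N\<^esub> \<and>
     (\<forall>x\<in>carrier M. \<forall>y\<in>carrier M. h (x \<oplus>\<^bsub>M\<^esub> y) = h x \<oplus>\<^bsub>N\<^esub> h y) \<and>
     (\<forall>a\<in>carrier R. \<forall>x\<in>carrier M. h (a \<odot>\<^bsub>M\<^esub> x) = a \<odot>\<^bsub>N\<^esub> h x)}"

definition semimodule_isomorphic ::
    "('a, 'c) ring_scheme \<Rightarrow> ('a, 'b, 'd) module_scheme \<Rightarrow> ('a, 'e, 'f) module_scheme \<Rightarrow> bool"
  where
  "semimodule_isomorphic R M N \<longleftrightarrow> semimodule_iso R M N \<noteq> {}"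

text \<open>
  The quotient by an equivalence relation \<open>r\<close>. The operations take the union over all
  representatives, so the carrier is closed under them (as the semimodule laws demand) precisely
  when \<open>r\<close> is compatible with addition and with the action.
\<close>

definition quotient_semimodule ::
    "('a, 'b, 'd) module_scheme \<Rightarrow> ('b \<times> 'b) set \<Rightarrow> ('a, 'b set) module" where
  "quotient_semimodule M r =
     \<lparr>carrier = carrier M // r, mult = undefined, one = undefined,
      zero = r `` {\<zero>\<^bsub>M\<^esub>},
      add = (\<lambda>A B. \<Union>x\<in>A. \<Union>y\<in>B. r `` {x \<oplus>\<^bsub>M\<^esub> y}),
      smult = (\<lambda>a A. \<Union>x\<in>A. r `` {a \<odot>\<^bsub>M\<^esub> x})\<rparr>"

text \<open>The equivalence relation on \<open>M\<close> whose only possibly non-singleton class is \<open>K\<close>.\<close>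

definition identify :: "('a, 'b, 'd) module_scheme \<Rightarrow> 'b set \<Rightarrow> ('b \<times> 'b) set" where
  "identify M K = Id_on (carrier M) \<union> K \<times> K"


section \<open>Dihedral groups\<close>

datatype letter = S | T

text \<open>
  The congruence on words in \<open>S\<close>, \<open>T\<close> generated by the defining relations of the dihedral
  group of order \<open>2n\<close>. The generators are involutions, so inverse letters are not needed and the
  monoid presented in this way is the group with the same presentation.
\<close>

inductive dih_eq :: "nat \<Rightarrow> letter list \<Rightarrow> letter list \<Rightarrow> bool" for n where
  refl: "dih_eq n u u"
| sym: "dih_eq n u v \<Longrightarrow> dih_eq n v u"
| trans: "dih_eq n u v \<Longrightarrow> dih_eq n v w \<Longrightarrow> dih_eq n u w"
| invol: "dih_eq n (u @ [a, a] @ v) (u @ v)"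
| ST: "dih_eq n (u @ concat (replicate n [S, T]) @ v) (u @ v)"
| TS: "dih_eq n (u @ concat (replicate n [T, S]) @ v) (u @ v)"

definition dih_class :: "nat \<Rightarrow> letter list \<Rightarrow> letter list set" where
  "dih_class n u = {v. dih_eq n u v}"

definition dihedral :: "nat \<Rightarrow> letter list set monoid" where
  "dihedral n =
     \<lparr>carrier = range (dih_class n),
      mult = (\<lambda>A B. \<Union>u\<in>A. \<Union>v\<in>B. dih_class n (u @ v)),
      one = dih_class n []\<rparr>"

definition dih_length :: "letter list set \<Rightarrow> nat" where
  "dih_length w = (LEAST k. \<exists>u\<in>w. length u = k)"

fun alternating :: "letter \<Rightarrow> nat \<Rightarrow> letter list" where
  "alternating a 0 = []"
| "alternating a (Suc k) = a # alternating (if a = S then T else S) k"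

definition longest :: "nat \<Rightarrow> letter list set" where
  "longest n = dih_class n (alternating S n)"

definition bruhat_le :: "letter list set \<Rightarrow> letter list set \<Rightarrow> bool" where
  "bruhat_le x w \<longleftrightarrow> x = w \<or> dih_length x < dih_length w"

text \<open>
  The index set of \<open>\<R>\<^sub>s\<close> (for \<open>a = S\<close>) and \<open>\<R>\<^sub>t\<close> (for \<open>a = T\<close>): a Kazhdan-Lusztig basis element
  is represented by the group element indexing it.
\<close>

definition right_cell :: "nat \<Rightarrow> letter \<Rightarrow> letter list set set" where
  "right_cell n a = {w \<in> carrier (dihedral n). w \<noteq> \<one>\<^bsub>dihedral n\<^esub> \<and> w \<noteq> longest n \<and>
     (\<exists>u. a # u \<in> w \<and> length (a # u) = dih_length w)}"


section \<open>The Kazhdan-Lusztig semiring\<close>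

definition group_ring :: "('g, 'm) monoid_scheme \<Rightarrow> ('g \<Rightarrow> int) ring" where
  "group_ring G =
     \<lparr>carrier = {f. finite {x. f x \<noteq> 0} \<and> {x. f x \<noteq> 0} \<subseteq> carrier G},
      mult = (\<lambda>f g x. \<Sum>(y, z) | y \<in> carrier G \<and> z \<in> carrier G \<and> f y \<noteq> 0 \<and> g z \<noteq> 0 \<and>
                y \<otimes>\<^bsub>G\<^esub> z = x. f y * g z),
      one = (\<lambda>x. if x = \<one>\<^bsub>G\<^esub> then 1 else 0),
      zero = (\<lambda>x. 0),
      add = (\<lambda>f g x. f x + g x)\<rparr>"

inductive_set generate_semiring :: "('a, 'b) ring_scheme \<Rightarrow> 'a set \<Rightarrow> 'a set" for R and H where
  zero: "\<zero>\<^bsub>R\<^esub> \<in> generate_semiring R H"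
| one: "\<one>\<^bsub>R\<^esub> \<in> generate_semiring R H"
| incl: "h \<in> H \<Longrightarrow> h \<in> generate_semiring R H"
| add: "\<lbrakk>a \<in> generate_semiring R H; b \<in> generate_semiring R H\<rbrakk> \<Longrightarrow> a \<oplus>\<^bsub>R\<^esub> b \<in> generate_semiring R H"
| mult: "\<lbrakk>a \<in> generate_semiring R H; b \<in> generate_semiring R H\<rbrakk> \<Longrightarrow> a \<otimes>\<^bsub>R\<^esub> b \<in> generate_semiring R H"

definition kl :: "nat \<Rightarrow> letter list set \<Rightarrow> letter list set \<Rightarrow> int" where
  "kl n w = (\<lambda>x. if x \<in> carrier (dihedral n) \<and> bruhat_le x w then 1 else 0)"

definition kl_semiring :: "nat \<Rightarrow> (letter list set \<Rightarrow> int) ring" where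
  "kl_semiring n = (group_ring (dihedral n))
     \<lparr>carrier := generate_semiring (group_ring (dihedral n)) (kl n ` carrier (dihedral n))\<rparr>"

definition kl_coeff :: "nat \<Rightarrow> (letter list set \<Rightarrow> int) \<Rightarrow> letter list set \<Rightarrow> nat" where
  "kl_coeff n r = (THE c. (\<forall>w. w \<notin> carrier (dihedral n) \<longrightarrow> c w = 0) \<and>
     (\<forall>x. r x = (\<Sum>w\<in>carrier (dihedral n). int (c w) * kl n w x)))"


section \<open>The semimodules of the classification\<close>

text \<open>
  \<open>act w\<close> is the action of the basis element \<open>kl n w\<close> on the idempotent monoid \<open>('b, sup, bot)\<close>;
  it is extended additively along the expansion of a ring element in the Kazhdan-Lusztig basis.
\<close>

definition join_monoid :: "'b::bounded_semilattice_sup_bot ring" where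
  "join_monoid = \<lparr>carrier = UNIV, mult = undefined, one = undefined, zero = bot, add = sup\<rparr>"

definition kl_action_semimodule :: "nat \<Rightarrow> (letter list set \<Rightarrow> 'b \<Rightarrow> 'b) \<Rightarrow>
    (letter list set \<Rightarrow> int, 'b::bounded_semilattice_sup_bot) module" where
  "kl_action_semimodule n act = ring.extend join_monoid
     \<lparr>smult = (\<lambda>r m. \<Oplus>\<^bsub>join_monoid\<^esub>w\<in>carrier (dihedral n).
        [kl_coeff n r w] \<cdot>\<^bsub>join_monoid\<^esub> act w m)\<rparr>"

text \<open>The monoid \<open>{0, 1}\<close> with \<open>1 + 1 = 1\<close> is \<open>bool\<close> with disjunction.\<close>

definition C_e :: "nat \<Rightarrow> (letter list set \<Rightarrow> int, bool) module" where
  "C_e n = kl_action_semimodule n (\<lambda>w m. if w = \<one>\<^bsub>dihedral n\<^esub> then m else False)"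

definition C_w0 :: "nat \<Rightarrow> (letter list set \<Rightarrow> int, bool) module" where
  "C_w0 n = kl_action_semimodule n (\<lambda>w m. m)"

datatype point = X | Y

fun C_cell_act :: "nat \<Rightarrow> letter list set \<Rightarrow> point \<Rightarrow> point set" where
  "C_cell_act n w X = (if w = longest n then {} else if w \<in> right_cell n T then {Y} else {X})"
| "C_cell_act n w Y = (if w = longest n then {} else if w \<in> right_cell n S then {X} else {Y})"

definition C_cell :: "nat \<Rightarrow> (letter list set \<Rightarrow> int, point set) module" where
  "C_cell n = kl_action_semimodule n (\<lambda>w A. \<Union>p\<in>A. C_cell_act n w p)"

definition N1 :: "nat \<Rightarrow> (letter list set \<Rightarrow> int, point set set) module" where
  "N1 n = quotient_semimodule (C_cell n) (identify (C_cell n) {{X, Y}, {X}})"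

definition N2 :: "nat \<Rightarrow> (letter list set \<Rightarrow> int, point set set) module" where
  "N2 n = quotient_semimodule (C_cell n) (identify (C_cell n) {{X, Y}, {Y}})"

definition N3 :: "nat \<Rightarrow> (letter list set \<Rightarrow> int, point set set) module" where
  "N3 n = quotient_semimodule (C_cell n) (identify (C_cell n) {{X, Y}, {X}, {Y}})"


lemma carrier_C_cell: "carrier (C_cell n) = {{}, {X}, {Y}, {X, Y}}"
proof -
  have "A \<subseteq> {X, Y}" for A :: "point set"
    using point.exhaust by auto
  then show ?thesis
    by (auto simp: C_cell_def kl_action_semimodule_def ring.extend_def join_monoid_def)
qed

lemma
  shows carrier_N1: "carrier (N1 n) = {{{}}, {{X}, {X, Y}}, {{Y}}}"
    and carrier_N2: "carrier (N2 n) = {{{}}, {{Y}, {X, Y}}, {{X}}}"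
    and carrier_N3: "carrier (N3 n) = {{{}}, {{X}, {Y}, {X, Y}}}"
proof -
  have im: "identify (C_cell n) K `` {A} = (if A \<in> K then insert A K else {A})"
    if "A \<in> carrier (C_cell n)" for A K
    using that by (auto simp: identify_def)
  have q: "carrier (quotient_semimodule (C_cell n) (identify (C_cell n) K)) =
    (\<lambda>A. if A \<in> K then insert A K else {A}) ` carrier (C_cell n)" for K
    by (force simp: quotient_semimodule_def quotient_def im)
  have ne: "{X} \<noteq> {X, Y}" "{Y} \<noteq> {X, Y}" by auto
  show "carrier (N1 n) = {{{}}, {{X}, {X, Y}}, {{Y}}}"
    unfolding N1_def q carrier_C_cell using ne by (simp add: insert_commute)
  show "carrier (N2 n) = {{{}}, {{Y}, {X, Y}}, {{X}}}"
    unfolding N2_def q carrier_C_cell using ne by (simp add: insert_commute)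
  show "carrier (N3 n) = {{{}}, {{X}, {Y}, {X, Y}}}"
    unfolding N3_def q carrier_C_cell using ne by (simp add: insert_commute)
qed

end

theory Submission
  imports Defs
begin

text \<open>
  Write \<open>C a k\<close> for the Kazhdan-Lusztig element of the reduced word of length \<open>k\<close> with first letter
  \<open>a\<close>. For \<open>0 < k < n\<close> these elements form two cells, one for each letter; outside of them there are
  only the identity and the element of the longest word, which is the sum of the whole group and is
  therefore multiplied by every basis element into a multiple of itself.

  Multiplying \<open>C a k\<close> by a generator from either side either doubles it or gives
  \<open>C a (k + 1) + C a (k - 1)\<close> (\<open>generator_mult_left\<close>, \<open>generator_mult_right\<close>), which is the recursion
  of the Chebyshev polynomials truncated at \<open>n\<close>. Two consequences are used throughout. The structure
  constants are non-negative, so the semiring is the non-negative span of the basis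
  (\<open>carrier_eq_nonneg_span\<close>) and a semimodule structure is determined by the action of the basis. And
  the product of two cell elements contains, besides a multiple of the longest element, at least one
  element of the cell of the left factor and none of the other cell (\<open>C_mult_C\<close>). On an idempotent
  monoid multiplicities do not matter, and this is all one has to know in order to see that the six
  objects are semimodules (\<open>semimodule_kl_action\<close>).

  Conversely, let \<open>M\<close> be minimal and proper. Its invertible elements form a subsemimodule, hence \<open>0\<close>
  is the only one, and the doubled elements \<open>x + x\<close> form a subsemimodule, hence every element is a
  double. As \<open>M\<close> is generated additively by the finitely many images of one element under the basis,
  it contains a non-zero idempotent (\<open>exists_idempotent\<close>); the idempotents form a subsemimodule, so
  \<open>M\<close> is a join-semilattice (\<open>minimal_proper_idempotent\<close>). Now there are three cases. If the longest
  element does not kill some \<open>m\<close>, the image of \<open>m\<close> is fixed by the basis and \<open>M\<close> has two elements. If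
  it kills \<open>M\<close>, and both generators kill some \<open>m \<noteq> 0\<close>, then again \<open>M = {0, m}\<close>. Otherwise the sums
  \<open>p S\<close>, \<open>p T\<close> of the two cells, applied to any \<open>m \<noteq> 0\<close>, satisfy \<open>C a 1 p b = p a\<close>, and the product
  formulas force \<open>C a k p b = p a\<close> for all \<open>0 < k < n\<close> (\<open>C_act_pair\<close>). So \<open>M = {0, p S, p T, p S + p T}\<close>
  is an image of the four-element semimodule, and which of the three non-zero elements coincide
  decides between this semimodule and its three quotients (\<open>isomorphic_cell\<close>).
\<close>

section \<open>Normal forms in the dihedral group\<close>

definition flip :: "letter \<Rightarrow> letter" where
  "flip a = (if a = S then T else S)"

lemma flip_simps [simp]: "flip S = T" "flip T = S" "flip (flip a) = a" "flip a \<noteq> a" "a \<noteq> flip a"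
  by (cases a; simp add: flip_def)+

lemma flip_eq_iff [simp]: "flip a = flip b \<longleftrightarrow> a = b"
  by (cases a; cases b; simp)

lemma neq_iff_flip: "a \<noteq> b \<longleftrightarrow> b = flip a"
  by (cases a; cases b; simp)

lemma alternating_Suc [simp]: "alternating a (Suc k) = a # alternating (flip a) k"
  by (simp add: flip_def)

declare alternating.simps(2) [simp del]

lemma length_alternating [simp]: "length (alternating a k) = k"
  by (induction k arbitrary: a) simp_all

lemma dih_eq_append:
  assumes "dih_eq n u v"
  shows "dih_eq n (p @ u @ q) (p @ v @ q)"
  using assms
proof induction
  case (invol u a v)
  then show ?case using dih_eq.invol[of n "p @ u" a "v @ q"] by simp
next
  case (ST u v)
  then show ?case using dih_eq.ST[of n "p @ u" "v @ q"] by simp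
next
  case (TS u v)
  then show ?case using dih_eq.TS[of n "p @ u" "v @ q"] by simp
next
  case (trans u v w)
  show ?case by (rule dih_eq.trans[OF trans.IH])
qed (auto intro: dih_eq.refl dih_eq.sym)

lemma dih_eq_append2:
  assumes "dih_eq n u u'" "dih_eq n v v'"
  shows "dih_eq n (u @ v) (u' @ v')"
  using dih_eq_append[OF assms(1), of "[]" v] dih_eq_append[OF assms(2), of u' "[]"]
  by (metis append_Nil append_Nil2 dih_eq.trans)

lemma dih_eq_Cons: "dih_eq n u v \<Longrightarrow> dih_eq n (a # u) (a # v)"
  using dih_eq_append[of n u v "[a]" "[]"] by simp

lemma dih_eq_cancel: "dih_eq n (a # a # u) u"
  using dih_eq.invol[of n "[]" a u] by simp

lemma dih_class_eq_iff: "dih_class n u = dih_class n v \<longleftrightarrow> dih_eq n u v"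
  unfolding dih_class_def set_eq_iff mem_Collect_eq
  by (metis dih_eq.refl dih_eq.sym dih_eq.trans)

lemma mem_dih_class: "v \<in> dih_class n u \<longleftrightarrow> dih_eq n u v"
  by (simp add: dih_class_def)

lemma dihedral_mult:
  "dih_class n u \<otimes>\<^bsub>dihedral n\<^esub> dih_class n v = dih_class n (u @ v)"
proof -
  have "dih_class n (u' @ v') = dih_class n (u @ v)"
    if "u' \<in> dih_class n u" "v' \<in> dih_class n v" for u' v'
    using that dih_eq_append2 by (metis dih_class_eq_iff mem_dih_class)
  moreover have "u \<in> dih_class n u" "v \<in> dih_class n v"
    by (simp_all add: mem_dih_class dih_eq.refl)
  ultimately have "(\<Union>u'\<in>dih_class n u. \<Union>v'\<in>dih_class n v. dih_class n (u' @ v')) = dih_class n (u @ v)"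
    by blast
  then show ?thesis by (simp add: dihedral_def)
qed

lemma monoid_dihedral: "Group.monoid (dihedral n)"
proof -
  have c: "x \<in> carrier (dihedral n) \<longleftrightarrow> (\<exists>u. x = dih_class n u)" for x
    by (auto simp: dihedral_def)
  have o: "\<one>\<^bsub>dihedral n\<^esub> = dih_class n []"
    by (simp add: dihedral_def)
  show ?thesis
    by (rule Group.monoidI) (auto simp: c o dihedral_mult)
qed

lemma concat_replicate_alternating:
  "concat (replicate k [a, flip a]) = alternating a (2 * k)"
  by (induction k) simp_all

text \<open>
  The relations say that an alternating word of length \<open>2n\<close> is trivial; moving \<open>k\<close> of its letters
  to the other side gives the following. The case \<open>k = n\<close> is the braid relation.
\<close>

lemma alternating_complement:
  "k \<le> 2 * n \<Longrightarrow> dih_eq n (alternating a k) (alternating (flip a) (2 * n - k))"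
proof (induction k arbitrary: a)
  case 0
  have "dih_eq n (alternating b (2 * n)) []" for b
    using dih_eq.ST[of n "[]" "[]"] dih_eq.TS[of n "[]" "[]"]
      concat_replicate_alternating[of n S] concat_replicate_alternating[of n T]
    by (cases b) simp_all
  then show ?case by (simp add: dih_eq.sym)
next
  case (Suc k)
  have "dih_eq n (a # alternating (flip a) k) (a # alternating a (2 * n - k))"
    using dih_eq_Cons Suc.IH[of "flip a"] Suc.prems by simp
  moreover have "alternating a (2 * n - k) = a # alternating (flip a) (2 * n - Suc k)"
    using Suc.prems by (metis Suc_diff_Suc Suc_le_lessD alternating_Suc)
  ultimately show ?case
    using dih_eq_cancel dih_eq.trans by fastforce
qed

lemma braid: "dih_eq n (alternating a n) (alternating b n)"
  using alternating_complement[of n n a] dih_eq.refl[of n "alternating a n"] neq_iff_flip[of a b]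
  by (cases "a = b") (simp_all add: mult_2)

text \<open>
  Letters are added from the left: a repeated letter cancels, and at length \<open>n\<close> the braid relation
  exchanges the first letter, so that the next letter can always be cancelled.
\<close>

lemma reduce_to_alternating:
  assumes "n > 0"
  shows "\<exists>a k. k \<le> n \<and> k \<le> length u \<and> dih_eq n u (alternating a k)"
proof (induction u)
  case Nil
  have "dih_eq n [] (alternating S 0)" by (simp add: dih_eq.refl)
  then show ?case by fastforce
next
  case (Cons b u)
  then obtain a k where k: "k \<le> n" "k \<le> length u" and "dih_eq n u (alternating a k)"
    by blast
  then have eq: "dih_eq n (b # u) (b # alternating a k)"
    by (simp add: dih_eq_Cons)
  show ?case
  proof (cases "a \<noteq> b \<and> k < n")
    case True
    then have "b # alternating a k = alternating b (Suc k)"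
      by (simp add: neq_iff_flip)
    with eq k True show ?thesis
      by (intro exI[of _ b] exI[of _ "Suc k"]) simp
  next
    case False
    then have "k = 0 \<or> (\<exists>j. k = Suc j \<and> dih_eq n (alternating a k) (alternating b k))"
      using braid[of n a b] k by (cases k) (auto intro: dih_eq.refl)
    then show ?thesis
    proof (elim disjE exE conjE)
      assume "k = 0"
      then have "dih_eq n (b # u) (alternating b (Suc 0))" using eq by simp
      with assms show ?thesis
        by (intro exI[of _ b] exI[of _ "Suc 0"]) simp
    next
      fix j assume j: "k = Suc j" "dih_eq n (alternating a k) (alternating b k)"
      then have "dih_eq n (b # u) (alternating (flip b) j)"
        using eq dih_eq_Cons[OF j(2), of b] dih_eq_cancel[of n b "alternating (flip b) j"]
        by (metis alternating_Suc dih_eq.trans)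
      with j k show ?thesis
        by (intro exI[of _ "flip b"] exI[of _ j]) simp
    qed
  qed
qed

text \<open>
  The dihedral group acts simply transitively on the \<open>2n\<close> chambers, labelled cyclically by the
  integers modulo \<open>2n\<close>: the two simple reflections exchange the base chamber \<open>0\<close> with its
  neighbours \<open>-1\<close> and \<open>1\<close>. The image of the base chamber separates the group elements.
\<close>

fun reflect :: "letter \<Rightarrow> int \<Rightarrow> int" where
  "reflect S y = - 1 - y"
| "reflect T y = 1 - y"

definition chamber :: "letter list \<Rightarrow> int \<Rightarrow> int" where
  "chamber u y = foldr reflect u y"

lemma chamber_append: "chamber (u @ v) y = chamber u (chamber v y)"
  by (simp add: chamber_def)

lemma chamber_Cons: "chamber (a # v) y = reflect a (chamber v y)"
  by (simp add: chamber_def)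

lemma chamber_cong:
  assumes "m dvd y - y'"
  shows "m dvd chamber u y - chamber u y'"
proof (induction u)
  case Nil
  then show ?case using assms by (simp add: chamber_def)
next
  case (Cons a u)
  then show ?case
    by (cases a) (simp_all add: chamber_def dvd_diff_commute)
qed

lemma chamber_alternating_even:
  "chamber (alternating a (2 * k)) y = (if a = T then y + 2 * int k else y - 2 * int k)"
  by (induction k) (cases a; simp add: chamber_def)+

lemma chamber_dih_eq:
  assumes "dih_eq n u v"
  shows "2 * int n dvd chamber u y - chamber v y"
  using assms
proof (induction arbitrary: y)
  case (sym u v)
  then show ?case using dvd_diff_commute by blast
next
  case (trans u v w)
  have "2 * int n dvd (chamber u y - chamber v y) + (chamber v y - chamber w y)"
    using trans.IH by (meson dvd_add)
  then show ?case by simp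
next
  case (invol u a v)
  have "reflect a (reflect a w) = w" for w by (cases a) simp_all
  then show ?case by (simp add: chamber_append chamber_Cons)
next
  case (ST u v)
  have "2 * int n dvd chamber (alternating S (2 * n)) (chamber v y) - chamber v y"
    unfolding chamber_alternating_even by simp
  then show ?case
    using concat_replicate_alternating[of n S]
    by (simp add: chamber_append chamber_cong)
next
  case (TS u v)
  have "2 * int n dvd chamber (alternating T (2 * n)) (chamber v y) - chamber v y"
    unfolding chamber_alternating_even by simp
  then show ?case
    using concat_replicate_alternating[of n T]
    by (simp add: chamber_append chamber_cong)
qed simp

lemma chamber_alternating: "chamber (alternating a k) 0 = (if a = T then int k else - int k)"
proof (induction k arbitrary: a)
  case (Suc k)
  then show ?case by (cases a) (simp_all add: chamber_Cons)
qed (simp add: chamber_def)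

text \<open>
  The labels of the alternating words of length at most \<open>n\<close> range over \<open>{-n..n}\<close>, where only the two
  end points are congruent modulo \<open>2n\<close>.
\<close>

lemma dih_eq_alternating_iff:
  assumes "j \<le> n" "k \<le> n"
  shows "dih_eq n (alternating a j) (alternating b k) \<longleftrightarrow> j = k \<and> (a = b \<or> k = 0 \<or> k = n)"
proof
  assume "dih_eq n (alternating a j) (alternating b k)"
  then have d: "2 * int n dvd
      (if a = T then int j else - int j) - (if b = T then int k else - int k)"
    using chamber_dih_eq[of n "alternating a j" "alternating b k" 0]
    by (simp only: chamber_alternating)
  define e where "e = (if a = T then int j else - int j) - (if b = T then int k else - int k)"
  have "\<bar>e\<bar> \<le> 2 * int n" using assms by (auto simp: e_def)
  obtain c where c: "e = 2 * int n * c" using d unfolding e_def by (elim dvdE)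
  have "n = 0 \<or> \<bar>c\<bar> \<le> 1"
  proof (rule ccontr)
    assume neg: "\<not> (n = 0 \<or> \<bar>c\<bar> \<le> 1)"
    then have "2 * int n * 2 \<le> 2 * int n * \<bar>c\<bar>" by (intro mult_left_mono) auto
    also have "\<dots> = \<bar>e\<bar>" by (simp add: c abs_mult)
    finally show False using \<open>\<bar>e\<bar> \<le> 2 * int n\<close> neg by simp
  qed
  moreover have "c = 0 \<or> c = 1 \<or> c = - 1" if "\<bar>c\<bar> \<le> 1" using that by linarith
  ultimately have "e = 0 \<or> e = 2 * int n \<or> e = - 2 * int n"
    using c by auto
  then show "j = k \<and> (a = b \<or> k = 0 \<or> k = n)"
    using assms unfolding e_def by (cases a; cases b) auto
next
  assume "j = k \<and> (a = b \<or> k = 0 \<or> k = n)"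
  then show "dih_eq n (alternating a j) (alternating b k)"
    using braid[of n a b] by (auto intro: dih_eq.refl)
qed

definition wd :: "nat \<Rightarrow> letter \<Rightarrow> nat \<Rightarrow> letter list set" where
  "wd n a k = dih_class n (alternating a k)"

lemma wd_eq_iff:
  "j \<le> n \<Longrightarrow> k \<le> n \<Longrightarrow> wd n a j = wd n b k \<longleftrightarrow> j = k \<and> (a = b \<or> k = 0 \<or> k = n)"
  by (simp add: wd_def dih_class_eq_iff dih_eq_alternating_iff)

lemma wd_0: "wd n a 0 = \<one>\<^bsub>dihedral n\<^esub>"
  by (simp add: wd_def dihedral_def)

lemma wd_n: "wd n a n = longest n"
  using braid[of n a S] by (simp add: wd_def longest_def dih_class_eq_iff)

lemma wd_in_carrier [simp]: "wd n a k \<in> carrier (dihedral n)"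
  by (simp add: wd_def dihedral_def)

lemma carrier_dihedral_wd:
  assumes "n > 0"
  shows "carrier (dihedral n) = {wd n a k |a k. k \<le> n}"
proof -
  have "\<exists>a k. dih_class n u = wd n a k \<and> k \<le> n" for u
    using reduce_to_alternating[OF assms, of u] by (metis dih_class_eq_iff wd_def)
  then show ?thesis by (auto simp: dihedral_def wd_def)
qed

lemma wd_cases:
  assumes "n > 0" "x \<in> carrier (dihedral n)"
  obtains a k where "k \<le> n" "x = wd n a k"
  using assms by (auto simp: carrier_dihedral_wd)

lemma finite_dihedral:
  assumes "n > 0"
  shows "finite (carrier (dihedral n))"
proof (rule finite_subset)
  show "carrier (dihedral n) \<subseteq> wd n S ` {..n} \<union> wd n T ` {..n}"
  proof
    fix x assume "x \<in> carrier (dihedral n)"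
    then obtain a k where "k \<le> n" "x = wd n a k" by (rule wd_cases[OF assms])
    then show "x \<in> wd n S ` {..n} \<union> wd n T ` {..n}" by (cases a) auto
  qed
qed simp

lemma length_in_wd:
  assumes "n > 0" "k \<le> n" "v \<in> wd n a k"
  shows "k \<le> length v"
proof -
  obtain b j where j: "j \<le> n" "j \<le> length v" "dih_eq n v (alternating b j)"
    using reduce_to_alternating[OF assms(1)] by blast
  then have "dih_eq n (alternating a k) (alternating b j)"
    using assms(3) dih_eq.trans by (auto simp: wd_def mem_dih_class)
  then show ?thesis
    using dih_eq_alternating_iff j assms by auto
qed

lemma dih_length_wd:
  assumes "n > 0" "k \<le> n"
  shows "dih_length (wd n a k) = k"
  unfolding dih_length_def
proof (rule Least_equality)
  show "\<exists>u\<in>wd n a k. length u = k"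
    using length_alternating by (metis dih_eq.refl mem_dih_class wd_def)
qed (use length_in_wd assms in auto)

lemma wd_mult_left:
  "wd n a 1 \<otimes>\<^bsub>dihedral n\<^esub> wd n (flip a) k = wd n a (Suc k)"
  "wd n a 1 \<otimes>\<^bsub>dihedral n\<^esub> wd n a (Suc k) = wd n (flip a) k"
  using dih_eq_cancel[of n a "alternating (flip a) k"]
  by (simp_all add: wd_def dihedral_mult dih_class_eq_iff)

text \<open>
  The last letter of the alternating word of length \<open>k\<close> that starts with \<open>a\<close>, and by symmetry its
  first letter if \<open>a\<close> is the last one. The value at \<open>k = 0\<close> makes \<open>other_end_Suc\<close> hold everywhere.
\<close>

definition other_end :: "letter \<Rightarrow> nat \<Rightarrow> letter" where
  "other_end a k = (if odd k then a else flip a)"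

lemma other_end_Suc: "other_end a (Suc k) = flip (other_end a k)"
  by (simp add: other_end_def)

lemma other_end_flip: "other_end (flip a) k = flip (other_end a k)"
  by (simp add: other_end_def)

lemma other_end_other_end [simp]: "other_end (other_end a k) k = a"
  by (simp add: other_end_def)

lemma alternating_snoc: "alternating a (Suc k) = alternating a k @ [other_end a (Suc k)]"
proof (induction k arbitrary: a)
  case (Suc k)
  have "alternating a (Suc (Suc k)) = a # alternating (flip a) k @ [other_end (flip a) (Suc k)]"
    using Suc.IH[of "flip a"] by simp
  then show ?case by (simp add: other_end_def)
qed (simp add: other_end_def)

lemma wd_mult_right:
  "wd n a k \<otimes>\<^bsub>dihedral n\<^esub> wd n (other_end a (Suc k)) 1 = wd n a (Suc k)"
  "wd n a (Suc k) \<otimes>\<^bsub>dihedral n\<^esub> wd n (other_end a (Suc k)) 1 = wd n a k"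
  using dih_eq.invol[of n "alternating a k" "other_end a (Suc k)" "[]"]
    alternating_Suc[of "other_end a (Suc k)" 0]
  by (simp_all add: wd_def dihedral_mult dih_class_eq_iff alternating_snoc[of a k] dih_eq.refl
      del: alternating_Suc)

text \<open>
  A reduced word that starts with \<open>a\<close> becomes shorter when multiplied by \<open>a\<close>, whereas the
  alternating word that starts with the other letter becomes longer, as long as its length is below
  \<open>n\<close>.
\<close>

lemma right_cell_wd:
  assumes "n > 0"
  shows "right_cell n a = {wd n a k |k. 0 < k \<and> k < n}"
proof (intro equalityI subsetI)
  fix w assume "w \<in> right_cell n a"
  then obtain u where w: "w \<in> carrier (dihedral n)" "w \<noteq> \<one>\<^bsub>dihedral n\<^esub>" "w \<noteq> longest n"
    and u: "a # u \<in> w" "length (a # u) = dih_length w"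
    by (auto simp: right_cell_def)
  obtain b k where k: "k \<le> n" "w = wd n b k"
    using w(1) assms wd_cases by blast
  have "0 < k" "k < n"
    using w k wd_0 wd_n by (cases "k = 0"; cases "k = n"; force)+
  moreover have "a = b"
  proof (rule ccontr)
    assume "a \<noteq> b"
    then have b: "b = flip a" by (simp add: neq_iff_flip)
    have "dih_eq n (a # alternating b k) (a # a # u)"
      using u(1) k(2) by (simp add: wd_def mem_dih_class dih_eq_Cons)
    then have "dih_eq n (alternating a (Suc k)) u"
      using b dih_eq_cancel dih_eq.trans by fastforce
    then have "Suc k \<le> length u"
      using length_in_wd[OF assms] \<open>k < n\<close> by (simp add: wd_def mem_dih_class)
    then show False using u(2) k dih_length_wd[OF assms] by simp
  qed
  ultimately show "w \<in> {wd n a k |k. 0 < k \<and> k < n}" using k by auto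
next
  fix w assume "w \<in> {wd n a k |k. 0 < k \<and> k < n}"
  then obtain k where k: "0 < k" "k < n" "w = wd n a k" by auto
  then obtain j where j: "k = Suc j" by (cases k) auto
  have "a # alternating (flip a) j \<in> w"
    using dih_eq.refl by (simp add: k j wd_def mem_dih_class)
  moreover have "length (a # alternating (flip a) j) = dih_length w"
    using k j dih_length_wd[OF assms] by simp
  moreover have "w \<noteq> \<one>\<^bsub>dihedral n\<^esub>" "w \<noteq> longest n"
    using wd_eq_iff[of k n 0 a a] wd_eq_iff[of k n n a a] k by (simp_all add: wd_0 wd_n)
  ultimately show "w \<in> right_cell n a"
    using k by (auto simp: right_cell_def)
qed

lemma kl_wd:
  assumes "n > 0" "j \<le> n" "k \<le> n"
  shows "kl n (wd n b k) (wd n a j) = (if j < k \<or> j = k \<and> (a = b \<or> k = 0 \<or> k = n) then 1 else 0)"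
  using assms by (auto simp: kl_def bruhat_le_def dih_length_wd wd_eq_iff)

lemma kl_outside: "x \<notin> carrier (dihedral n) \<Longrightarrow> kl n w x = 0"
  by (simp add: kl_def)

section \<open>The group semiring\<close>

locale finite_monoid = Group.monoid G for G (structure) +
  assumes finite_carrier: "finite (carrier G)"
begin

lemma carrier_group_ring: "f \<in> carrier (group_ring G) \<longleftrightarrow> (\<forall>x. x \<notin> carrier G \<longrightarrow> f x = 0)"
  using finite_carrier by (auto simp: group_ring_def intro: finite_subset)

lemma group_ring_mult:
  "(f \<otimes>\<^bsub>group_ring G\<^esub> g) x = (\<Sum>y\<in>carrier G. \<Sum>z\<in>carrier G. if y \<otimes> z = x then f y * g z else 0)"
proof -
  have "(f \<otimes>\<^bsub>group_ring G\<^esub> g) x =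
      (\<Sum>p\<in>carrier G \<times> carrier G. case p of (y, z) \<Rightarrow> if y \<otimes> z = x then f y * g z else 0)"
    unfolding group_ring_def
    by simp (rule sum.mono_neutral_cong_left, use finite_carrier in \<open>auto split: if_splits\<close>)
  then show ?thesis by (simp add: sum.cartesian_product)
qed

lemma group_ring_mult_outside: "x \<notin> carrier G \<Longrightarrow> (f \<otimes>\<^bsub>group_ring G\<^esub> g) x = 0"
  unfolding group_ring_mult by (intro sum.neutral ballI) auto

text \<open>The product is the push-forward of the measure \<open>f y * g z\<close> along multiplication.\<close>

lemma sum_group_ring_mult:
  "(\<Sum>w\<in>carrier G. h w * (f \<otimes>\<^bsub>group_ring G\<^esub> g) w) =
     (\<Sum>y\<in>carrier G. \<Sum>z\<in>carrier G. h (y \<otimes> z) * (f y * g z))"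
proof -
  have "(\<Sum>w\<in>carrier G. h w * (f \<otimes>\<^bsub>group_ring G\<^esub> g) w) =
      (\<Sum>w\<in>carrier G. \<Sum>y\<in>carrier G. \<Sum>z\<in>carrier G. if y \<otimes> z = w then h w * (f y * g z) else 0)"
    unfolding group_ring_mult sum_distrib_left by (intro sum.cong) simp_all
  also have "\<dots> =
      (\<Sum>y\<in>carrier G. \<Sum>w\<in>carrier G. \<Sum>z\<in>carrier G. if y \<otimes> z = w then h w * (f y * g z) else 0)"
    by (rule sum.swap)
  also have "\<dots> =
      (\<Sum>y\<in>carrier G. \<Sum>z\<in>carrier G. \<Sum>w\<in>carrier G. if y \<otimes> z = w then h w * (f y * g z) else 0)"
    by (rule sum.cong[OF HOL.refl sum.swap])
  also have "\<dots> = (\<Sum>y\<in>carrier G. \<Sum>z\<in>carrier G. h (y \<otimes> z) * (f y * g z))"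
    using finite_carrier by (intro sum.cong) simp_all
  finally show ?thesis .
qed

lemma group_ring_mult_assoc:
  "(f \<otimes>\<^bsub>group_ring G\<^esub> g) \<otimes>\<^bsub>group_ring G\<^esub> h = f \<otimes>\<^bsub>group_ring G\<^esub> (g \<otimes>\<^bsub>group_ring G\<^esub> h)"
proof
  fix x
  let ?t = "\<lambda>u v z. if u \<otimes> v \<otimes> z = x then f u * g v * h z else 0"
  have "((f \<otimes>\<^bsub>group_ring G\<^esub> g) \<otimes>\<^bsub>group_ring G\<^esub> h) x =
      (\<Sum>z\<in>carrier G. \<Sum>w\<in>carrier G. (if w \<otimes> z = x then h z else 0) * (f \<otimes>\<^bsub>group_ring G\<^esub> g) w)"
    unfolding group_ring_mult[of "f \<otimes>\<^bsub>group_ring G\<^esub> g"]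
    by (subst sum.swap) (intro sum.cong; simp)
  also have "\<dots> = (\<Sum>z\<in>carrier G. \<Sum>u\<in>carrier G. \<Sum>v\<in>carrier G. ?t u v z)"
    unfolding sum_group_ring_mult by (intro sum.cong) simp_all
  also have "\<dots> = (\<Sum>u\<in>carrier G. \<Sum>z\<in>carrier G. \<Sum>v\<in>carrier G. ?t u v z)"
    by (rule sum.swap)
  also have "\<dots> = (\<Sum>u\<in>carrier G. \<Sum>v\<in>carrier G. \<Sum>z\<in>carrier G. ?t u v z)"
    by (rule sum.cong[OF HOL.refl sum.swap])
  also have "\<dots> = (\<Sum>u\<in>carrier G. \<Sum>w\<in>carrier G.
      (if u \<otimes> w = x then f u else 0) * (g \<otimes>\<^bsub>group_ring G\<^esub> h) w)"
    unfolding sum_group_ring_mult by (intro sum.cong) (simp_all add: m_assoc)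
  also have "\<dots> = (f \<otimes>\<^bsub>group_ring G\<^esub> (g \<otimes>\<^bsub>group_ring G\<^esub> h)) x"
    unfolding group_ring_mult[of f] by (intro sum.cong) simp_all
  finally show "((f \<otimes>\<^bsub>group_ring G\<^esub> g) \<otimes>\<^bsub>group_ring G\<^esub> h) x =
      (f \<otimes>\<^bsub>group_ring G\<^esub> (g \<otimes>\<^bsub>group_ring G\<^esub> h)) x" .
qed

text \<open>
  In a monoid, \<open>h z = x\<close> can be solved for \<open>z\<close> at least if \<open>h\<close> is an involution; then the
  convolution with the indicator of \<open>h\<close> has a single term.
\<close>

lemma group_ring_mult_involution:
  assumes "h \<in> carrier G" "h \<otimes> h = \<one>" "x \<in> carrier G"
  shows "((\<lambda>y. if y = h then 1 else 0) \<otimes>\<^bsub>group_ring G\<^esub> f) x = f (h \<otimes> x)"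
    and "(f \<otimes>\<^bsub>group_ring G\<^esub> (\<lambda>y. if y = h then 1 else 0)) x = f (x \<otimes> h)"
proof -
  have l: "h \<otimes> z = x \<longleftrightarrow> z = h \<otimes> x" and r: "z \<otimes> h = x \<longleftrightarrow> z = x \<otimes> h" if "z \<in> carrier G" for z
    using assms that by (metis l_one m_assoc, metis r_one m_assoc)
  have "((\<lambda>y. if y = h then 1 else 0) \<otimes>\<^bsub>group_ring G\<^esub> f) x =
      (\<Sum>y\<in>carrier G. if y = h then \<Sum>z\<in>carrier G. if y \<otimes> z = x then f z else 0 else 0)"
    unfolding group_ring_mult by (intro sum.cong) (auto intro!: sum.cong sum.neutral)
  also have "\<dots> = (\<Sum>z\<in>carrier G. if z = h \<otimes> x then f z else 0)"
    using finite_carrier assms l by (simp cong: sum.cong)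
  finally show "((\<lambda>y. if y = h then 1 else 0) \<otimes>\<^bsub>group_ring G\<^esub> f) x = f (h \<otimes> x)"
    using finite_carrier assms by simp
  have "(f \<otimes>\<^bsub>group_ring G\<^esub> (\<lambda>y. if y = h then 1 else 0)) x =
      (\<Sum>y\<in>carrier G. \<Sum>z\<in>carrier G. if z = h then if y \<otimes> h = x then f y else 0 else 0)"
    unfolding group_ring_mult by (intro sum.cong) auto
  also have "\<dots> = (\<Sum>y\<in>carrier G. if y = x \<otimes> h then f y else 0)"
    using finite_carrier assms r by (simp cong: sum.cong)
  finally show "(f \<otimes>\<^bsub>group_ring G\<^esub> (\<lambda>y. if y = h then 1 else 0)) x = f (x \<otimes> h)"
    using finite_carrier assms by simp
qed

lemma group_ring_one:
  assumes "f \<in> carrier (group_ring G)"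
  shows "\<one>\<^bsub>group_ring G\<^esub> \<otimes>\<^bsub>group_ring G\<^esub> f = f" "f \<otimes>\<^bsub>group_ring G\<^esub> \<one>\<^bsub>group_ring G\<^esub> = f"
proof -
  have "\<one>\<^bsub>group_ring G\<^esub> = (\<lambda>x. if x = \<one> then 1 else 0)"
    by (simp add: group_ring_def)
  then have "(\<one>\<^bsub>group_ring G\<^esub> \<otimes>\<^bsub>group_ring G\<^esub> f) x = f x"
    "(f \<otimes>\<^bsub>group_ring G\<^esub> \<one>\<^bsub>group_ring G\<^esub>) x = f x" for x
    using assms group_ring_mult_involution[of \<one> x f] group_ring_mult_outside[of x]
    by (cases "x \<in> carrier G"; simp add: carrier_group_ring)+
  then show "\<one>\<^bsub>group_ring G\<^esub> \<otimes>\<^bsub>group_ring G\<^esub> f = f"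
    "f \<otimes>\<^bsub>group_ring G\<^esub> \<one>\<^bsub>group_ring G\<^esub> = f" by blast+
qed

lemma semiring_group_ring: "semiring (group_ring G)"
proof -
  have add: "(f \<oplus>\<^bsub>group_ring G\<^esub> g) x = f x + g x" and zero: "\<zero>\<^bsub>group_ring G\<^esub> x = 0" for f g x
    by (simp_all add: group_ring_def)
  have distr: "(f \<oplus>\<^bsub>group_ring G\<^esub> g) \<otimes>\<^bsub>group_ring G\<^esub> h =
        (f \<otimes>\<^bsub>group_ring G\<^esub> h) \<oplus>\<^bsub>group_ring G\<^esub> (g \<otimes>\<^bsub>group_ring G\<^esub> h)"
      "h \<otimes>\<^bsub>group_ring G\<^esub> (f \<oplus>\<^bsub>group_ring G\<^esub> g) =
        (h \<otimes>\<^bsub>group_ring G\<^esub> f) \<oplus>\<^bsub>group_ring G\<^esub> (h \<otimes>\<^bsub>group_ring G\<^esub> g)" for f g h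
    by (rule ext, unfold add group_ring_mult sum.distrib[symmetric],
        intro sum.cong; simp add: algebra_simps add)+
  have null: "\<zero>\<^bsub>group_ring G\<^esub> \<otimes>\<^bsub>group_ring G\<^esub> f = \<zero>\<^bsub>group_ring G\<^esub>"
      "f \<otimes>\<^bsub>group_ring G\<^esub> \<zero>\<^bsub>group_ring G\<^esub> = \<zero>\<^bsub>group_ring G\<^esub>" for f
    by (auto simp: fun_eq_iff group_ring_mult zero intro!: sum.neutral)
  have one: "\<one>\<^bsub>group_ring G\<^esub> \<in> carrier (group_ring G)"
    unfolding carrier_group_ring by (auto simp: group_ring_def)
  show ?thesis
    by (intro semiring.intro semiring_axioms.intro abelian_monoidI Group.monoidI)
      (simp_all add: carrier_group_ring add zero distr null group_ring_mult_assoc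
        group_ring_one one[unfolded carrier_group_ring] group_ring_mult_outside fun_eq_iff)
qed

end

lemma generate_semiring_subset:
  assumes "semiring R" "H \<subseteq> carrier R"
  shows "generate_semiring R H \<subseteq> carrier R"
proof
  interpret semiring R by fact
  fix x assume "x \<in> generate_semiring R H"
  then show "x \<in> carrier R" by induction (use assms(2) in auto)
qed

lemma semiring_generate_semiring:
  assumes "semiring R" "H \<subseteq> carrier R"
  shows "semiring (R\<lparr>carrier := generate_semiring R H\<rparr>)"
proof -
  interpret semiring R by fact
  have c: "x \<in> carrier R" if "x \<in> generate_semiring R H" for x
    using generate_semiring_subset[OF assms] that by blast
  show ?thesis
    by (intro semiring.intro semiring_axioms.intro abelian_monoidI Group.monoidI)
      (auto intro: generate_semiring.intros simp: c a_ac m_assoc l_distr r_distr)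
qed

section \<open>Products of Kazhdan-Lusztig elements\<close>

locale kl_dihedral =
  fixes n :: nat
  assumes n_ge_3: "3 \<le> n"
begin

abbreviation R :: "(letter list set \<Rightarrow> int) ring" where
  "R \<equiv> kl_semiring n"

lemma n_pos: "0 < n"
  using n_ge_3 by simp

sublocale D: finite_monoid "dihedral n"
  by (intro finite_monoid.intro finite_monoid_axioms.intro monoid_dihedral finite_dihedral n_pos)

lemma kl_in_group_ring: "kl n w \<in> carrier (group_ring (dihedral n))"
  by (simp add: D.carrier_group_ring kl_outside)

sublocale R: semiring "kl_semiring n"
  unfolding kl_semiring_def
  by (rule semiring_generate_semiring[OF D.semiring_group_ring]) (use kl_in_group_ring in auto)

lemma R_add: "f \<oplus>\<^bsub>R\<^esub> g = (\<lambda>x. f x + g x)"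
  by (simp add: kl_semiring_def group_ring_def)

lemma R_zero: "\<zero>\<^bsub>R\<^esub> = (\<lambda>x. 0)"
  by (simp add: kl_semiring_def group_ring_def)

lemma R_mult: "f \<otimes>\<^bsub>R\<^esub> g = f \<otimes>\<^bsub>group_ring (dihedral n)\<^esub> g"
  by (simp add: kl_semiring_def)

lemma R_carrier: "carrier R = generate_semiring (group_ring (dihedral n)) (kl n ` carrier (dihedral n))"
  by (simp add: kl_semiring_def)

lemma kl_closed [simp]: "w \<in> carrier (dihedral n) \<Longrightarrow> kl n w \<in> carrier R"
  by (simp add: R_carrier generate_semiring.incl)

lemma R_carrier_outside: "f \<in> carrier R \<Longrightarrow> x \<notin> carrier (dihedral n) \<Longrightarrow> f x = 0"
  using generate_semiring_subset[OF D.semiring_group_ring, of "kl n ` carrier (dihedral n)"]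
    kl_in_group_ring D.carrier_group_ring by (fastforce simp: R_carrier)

lemma R_one: "\<one>\<^bsub>R\<^esub> = kl n (wd n a 0)"
proof
  fix x
  have one: "\<one>\<^bsub>R\<^esub> x = (if x = wd n a 0 then 1 else 0)"
    by (simp add: kl_semiring_def group_ring_def wd_0)
  show "\<one>\<^bsub>R\<^esub> x = kl n (wd n a 0) x"
  proof (cases "x \<in> carrier (dihedral n)")
    case True
    then obtain b j where "j \<le> n" "x = wd n b j" using wd_cases n_pos by blast
    then show ?thesis using n_pos unfolding one by (auto simp: wd_eq_iff kl_wd)
  next
    case False
    then show ?thesis unfolding one by (auto simp: kl_outside)
  qed
qed

text \<open>
  The element indexed by the reduced word of length \<open>k\<close> that starts with \<open>a\<close>. Starting the
  sequence with zero instead of the identity makes the product formulas uniform in \<open>k\<close>: they are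
  those of the Chebyshev polynomials.
\<close>

definition C :: "letter \<Rightarrow> nat \<Rightarrow> letter list set \<Rightarrow> int" where
  "C a k = (if k = 0 then \<zero>\<^bsub>R\<^esub> else kl n (wd n a k))"

lemma C_0 [simp]: "C a 0 = \<zero>\<^bsub>R\<^esub>"
  by (simp add: C_def)

lemma C_closed [simp]: "C a k \<in> carrier R"
  by (simp add: C_def)

lemma C_n: "C a n = C b n"
  using n_pos by (simp add: C_def wd_n)

lemma kl_generator:
  "C a 1 = (\<lambda>x. if x = \<one>\<^bsub>dihedral n\<^esub> then 1 else 0) \<oplus>\<^bsub>group_ring (dihedral n)\<^esub>
     (\<lambda>x. if x = wd n a 1 then 1 else 0)"
proof
  fix x
  have "kl n (wd n a 1) x = (if x = \<one>\<^bsub>dihedral n\<^esub> then 1 else 0) + (if x = wd n a 1 then 1 else 0)"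
  proof (cases "x \<in> carrier (dihedral n)")
    case True
    then obtain b j where j: "j \<le> n" "x = wd n b j" using wd_cases n_pos by blast
    show ?thesis
      using n_ge_3 j(1) unfolding j(2) wd_0[of n a, symmetric]
      by (subst kl_wd) (auto simp: wd_eq_iff)
  next
    case False
    then show ?thesis by (auto simp: kl_outside)
  qed
  then show "C a 1 x = ((\<lambda>x. if x = \<one>\<^bsub>dihedral n\<^esub> then 1 else 0) \<oplus>\<^bsub>group_ring (dihedral n)\<^esub>
     (\<lambda>x. if x = wd n a 1 then 1 else 0)) x"
    by (simp add: C_def group_ring_def)
qed

lemma wd_1_involution: "wd n a 1 \<otimes>\<^bsub>dihedral n\<^esub> wd n a 1 = \<one>\<^bsub>dihedral n\<^esub>"
  using wd_mult_left(2)[of n a 0] by (simp add: wd_0)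

lemma generator_mult:
  assumes f: "f \<in> carrier R" and x: "x \<in> carrier (dihedral n)"
  shows "(C a 1 \<otimes>\<^bsub>R\<^esub> f) x = f x + f (wd n a 1 \<otimes>\<^bsub>dihedral n\<^esub> x)"
    and "(f \<otimes>\<^bsub>R\<^esub> C a 1) x = f x + f (x \<otimes>\<^bsub>dihedral n\<^esub> wd n a 1)"
proof -
  interpret G: semiring "group_ring (dihedral n)" by (rule D.semiring_group_ring)
  let ?d = "\<lambda>h x. if x = h then 1 else 0 :: int"
  have d: "?d h \<in> carrier (group_ring (dihedral n))" if "h \<in> carrier (dihedral n)" for h
    using that by (auto simp: D.carrier_group_ring)
  have f': "f \<in> carrier (group_ring (dihedral n))"
    using f R_carrier_outside by (auto simp: D.carrier_group_ring)
  have add: "(g \<oplus>\<^bsub>group_ring (dihedral n)\<^esub> h) x = g x + h x" for g h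
    by (simp add: group_ring_def)
  show "(C a 1 \<otimes>\<^bsub>R\<^esub> f) x = f x + f (wd n a 1 \<otimes>\<^bsub>dihedral n\<^esub> x)"
    unfolding R_mult kl_generator G.l_distr[OF d[OF D.one_closed] d[OF wd_in_carrier] f'] add
    using D.group_ring_mult_involution[OF _ _ x] wd_1_involution x by simp
  show "(f \<otimes>\<^bsub>R\<^esub> C a 1) x = f x + f (x \<otimes>\<^bsub>dihedral n\<^esub> wd n a 1)"
    unfolding R_mult kl_generator G.r_distr[OF d[OF D.one_closed] d[OF wd_in_carrier] f'] add
    using D.group_ring_mult_involution[OF _ _ x] wd_1_involution x by simp
qed

text \<open>
  Multiplication by a generator pairs off elements of adjacent lengths, and a Kazhdan-Lusztig
  element is an indicator function that depends almost only on the length, so its symmetrisation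
  can be read off. Left and right multiplication are treated together: \<open>W b k\<close> is the element whose
  reduced word of length \<open>k\<close> has \<open>b\<close> at the end where the generator \<open>b\<close> is multiplied, and \<open>\<tau>\<close> is
  that multiplication.
\<close>

lemma symmetrize_kl:
  fixes W :: "letter \<Rightarrow> nat \<Rightarrow> letter list set"
  assumes W: "\<forall>x\<in>carrier (dihedral n). \<exists>a j. j \<le> n \<and> x = W a j"
    and kl_W: "\<forall>a c. \<forall>j\<le>n. \<forall>k\<le>n.
      kl n (W c k) (W a j) = (if j < k \<or> j = k \<and> (a = c \<or> k = 0 \<or> k = n) then 1 else 0)"
    and W_ends: "\<And>a c. W a n = W c n" "\<And>a c. W a 0 = W c 0"
    and \<tau>: "\<And>j. \<tau> (W (flip b) j) = W b (Suc j)" "\<And>j. \<tau> (W b (Suc j)) = W (flip b) j"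
    and x: "x \<in> carrier (dihedral n)" and k: "0 < k"
  shows "k \<le> n \<Longrightarrow> kl n (W b k) x + kl n (W b k) (\<tau> x) = 2 * kl n (W b k) x"
    and "k < n \<Longrightarrow> kl n (W (flip b) k) x + kl n (W (flip b) k) (\<tau> x) =
      kl n (W b (Suc k)) x + (if k = 1 then 0 else kl n (W b (k - 1)) x)"
proof -
  obtain a j where j: "j \<le> n" "x = W a j" using W x by blast
  consider i where "x = W b (Suc i)" "Suc i \<le> n" | i where "x = W (flip b) i" "i < n"
  proof (cases "a = b \<or> j = n")
    case True
    then have "x = W b j" using j W_ends(1) by metis
    then show ?thesis
      using that(1)[of "j - 1"] that(2)[of 0] W_ends(2)[of b "flip b"] n_pos j(1)
      by (cases j) auto
  next
    case False
    then show ?thesis using that(2)[of j] j neq_iff_flip[of b a] by auto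
  qed
  then have "(k \<le> n \<longrightarrow> kl n (W b k) x + kl n (W b k) (\<tau> x) = 2 * kl n (W b k) x) \<and>
    (k < n \<longrightarrow> kl n (W (flip b) k) x + kl n (W (flip b) k) (\<tau> x) =
      kl n (W b (Suc k)) x + (if k = 1 then 0 else kl n (W b (k - 1)) x))"
    by cases (use k n_ge_3 in \<open>auto simp: \<tau> kl_W\<close>)
  then show "k \<le> n \<Longrightarrow> kl n (W b k) x + kl n (W b k) (\<tau> x) = 2 * kl n (W b k) x"
    and "k < n \<Longrightarrow> kl n (W (flip b) k) x + kl n (W (flip b) k) (\<tau> x) =
      kl n (W b (Suc k)) x + (if k = 1 then 0 else kl n (W b (k - 1)) x)"
    by blast+
qed


lemma R_eqI:
  assumes "f \<in> carrier R" "g \<in> carrier R" "\<And>x. x \<in> carrier (dihedral n) \<Longrightarrow> f x = g x"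
  shows "f = g"
proof
  fix x
  show "f x = g x"
    using assms R_carrier_outside by metis
qed

lemma C_apply: "C a k x = (if k = 0 then 0 else kl n (wd n a k) x)"
  by (simp add: C_def R_zero)

lemma generator_mult_left:
  assumes "k \<le> n"
  shows "C a 1 \<otimes>\<^bsub>R\<^esub> C a k = C a k \<oplus>\<^bsub>R\<^esub> C a k"
    and "0 < k \<Longrightarrow> k < n \<Longrightarrow> C a 1 \<otimes>\<^bsub>R\<^esub> C (flip a) k = C a (Suc k) \<oplus>\<^bsub>R\<^esub> C a (k - 1)"
proof -
  have W: "\<forall>x\<in>carrier (dihedral n). \<exists>b j. j \<le> n \<and> x = wd n b j"
    using wd_cases[OF n_pos] by metis
  have kl_W: "\<forall>b c. \<forall>j\<le>n. \<forall>k\<le>n.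
      kl n (wd n c k) (wd n b j) = (if j < k \<or> j = k \<and> (b = c \<or> k = 0 \<or> k = n) then 1 else 0)"
    using kl_wd[OF n_pos] by blast
  have ends: "wd n b n = wd n c n" "wd n b 0 = wd n c 0" for b c
    by (simp_all add: wd_n wd_0)
  note sym = symmetrize_kl[of "wd n" "\<lambda>y. wd n a 1 \<otimes>\<^bsub>dihedral n\<^esub> y" a,
      OF W kl_W ends wd_mult_left]
  show "C a 1 \<otimes>\<^bsub>R\<^esub> C a k = C a k \<oplus>\<^bsub>R\<^esub> C a k"
  proof (rule R_eqI)
    fix x assume x: "x \<in> carrier (dihedral n)"
    show "(C a 1 \<otimes>\<^bsub>R\<^esub> C a k) x = (C a k \<oplus>\<^bsub>R\<^esub> C a k) x"
      using sym(1)[OF x _ assms] unfolding generator_mult(1)[OF C_closed x] R_add C_apply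
      by auto
  qed auto
  show "C a 1 \<otimes>\<^bsub>R\<^esub> C (flip a) k = C a (Suc k) \<oplus>\<^bsub>R\<^esub> C a (k - 1)" if k: "0 < k" "k < n"
  proof (rule R_eqI)
    fix x assume x: "x \<in> carrier (dihedral n)"
    show "(C a 1 \<otimes>\<^bsub>R\<^esub> C (flip a) k) x = (C a (Suc k) \<oplus>\<^bsub>R\<^esub> C a (k - 1)) x"
      using sym(2)[OF x k] k unfolding generator_mult(1)[OF C_closed x] R_add C_apply
      by auto
  qed auto
qed

text \<open>
  On the right it is the last letter that matters. Expressing it through the first one keeps the
  first letter the same on both sides, which is how the cell of a left factor is tracked.
\<close>

lemma generator_mult_right:
  assumes "k \<le> n"
  shows "C a k \<otimes>\<^bsub>R\<^esub> C (other_end a k) 1 = C a k \<oplus>\<^bsub>R\<^esub> C a k"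
    and "0 < k \<Longrightarrow> k < n \<Longrightarrow>
      C a k \<otimes>\<^bsub>R\<^esub> C (flip (other_end a k)) 1 = C a (Suc k) \<oplus>\<^bsub>R\<^esub> C a (k - 1)"
proof -
  let ?W = "\<lambda>b k. wd n (other_end b k) k"
  have W: "\<forall>x\<in>carrier (dihedral n). \<exists>b j. j \<le> n \<and> x = ?W b j"
    using wd_cases[OF n_pos] other_end_other_end by metis
  have kl_W: "\<forall>b c. \<forall>j\<le>n. \<forall>k\<le>n.
      kl n (?W c k) (?W b j) = (if j < k \<or> j = k \<and> (b = c \<or> k = 0 \<or> k = n) then 1 else 0)"
    using n_pos by (auto simp: kl_wd other_end_def)
  have ends: "?W b n = ?W c n" "?W b 0 = ?W c 0" for b c
    by (simp_all add: wd_n wd_0)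
  have \<tau>: "?W (flip b) j \<otimes>\<^bsub>dihedral n\<^esub> wd n b 1 = ?W b (Suc j)"
      "?W b (Suc j) \<otimes>\<^bsub>dihedral n\<^esub> wd n b 1 = ?W (flip b) j" for b j
    using wd_mult_right[of n "other_end b (Suc j)" j]
    by (simp_all add: other_end_Suc other_end_flip)
  note sym = symmetrize_kl[of ?W "\<lambda>y. y \<otimes>\<^bsub>dihedral n\<^esub> wd n b 1" b for b, OF W kl_W ends \<tau>]
  show "C a k \<otimes>\<^bsub>R\<^esub> C (other_end a k) 1 = C a k \<oplus>\<^bsub>R\<^esub> C a k"
  proof (rule R_eqI)
    fix x assume x: "x \<in> carrier (dihedral n)"
    show "(C a k \<otimes>\<^bsub>R\<^esub> C (other_end a k) 1) x = (C a k \<oplus>\<^bsub>R\<^esub> C a k) x"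
      using sym(1)[OF x _ assms, of "other_end a k"]
      unfolding generator_mult(2)[OF C_closed x] R_add C_apply by auto
  qed auto
  show "C a k \<otimes>\<^bsub>R\<^esub> C (flip (other_end a k)) 1 = C a (Suc k) \<oplus>\<^bsub>R\<^esub> C a (k - 1)"
    if k: "0 < k" "k < n"
  proof (rule R_eqI)
    obtain i where i: "k = Suc i" using k by (cases k) auto
    fix x assume x: "x \<in> carrier (dihedral n)"
    show "(C a k \<otimes>\<^bsub>R\<^esub> C (flip (other_end a k)) 1) x = (C a (Suc k) \<oplus>\<^bsub>R\<^esub> C a (k - 1)) x"
      using sym(2)[OF x k, of "flip (other_end a k)"] k
      unfolding generator_mult(2)[OF C_closed x] R_add C_apply
      by (auto simp: i other_end_Suc other_end_flip)
  qed auto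
qed

\<comment> \<open>The generators are \<open>C a 1\<close>; the formulas for them do not match after unfolding \<open>1\<close>.\<close>
declare One_nat_def [simp del]

text \<open>
  The element of the longest word is the sum of the group, so the factor is the number of group
  elements below the word of length \<open>j\<close>.
\<close>

lemma C_n_mult_C:
  assumes "j \<le> n"
  shows "C b n \<otimes>\<^bsub>R\<^esub> C a j = (\<lambda>x. 2 * int j * C b n x)"
  using assms
proof (induction j arbitrary: a rule: less_induct)
  case (less j)
  have gen: "C b n \<otimes>\<^bsub>R\<^esub> C a 1 = C b n \<oplus>\<^bsub>R\<^esub> C b n" for a
    using generator_mult_right(1)[of n "other_end a n"] C_n[of "other_end a n" b] by simp
  consider "j = 0" | "j = 1" | k where "j = Suc k" "0 < k" "k < n"
    using less.prems by (cases j) auto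
  then show ?case
  proof cases
    case 1
    then show ?thesis by (simp, simp add: R_zero)
  next
    case 2
    then show ?thesis using gen[of a] by (simp add: R_add fun_eq_iff)
  next
    case 3
    have "C b n \<otimes>\<^bsub>R\<^esub> C a j \<oplus>\<^bsub>R\<^esub> C b n \<otimes>\<^bsub>R\<^esub> C a (k - 1) =
        C b n \<otimes>\<^bsub>R\<^esub> (C a 1 \<otimes>\<^bsub>R\<^esub> C (flip a) k)"
      using 3 by (simp add: generator_mult_left R.r_distr)
    also have "\<dots> = C b n \<otimes>\<^bsub>R\<^esub> C (flip a) k \<oplus>\<^bsub>R\<^esub> C b n \<otimes>\<^bsub>R\<^esub> C (flip a) k"
      by (simp add: gen R.m_assoc[symmetric] R.l_distr)
    finally have "(C b n \<otimes>\<^bsub>R\<^esub> C a j) x + 2 * int (k - 1) * C b n x = 4 * int k * C b n x" for x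
      using 3 less.IH[of k "flip a"] less.IH[of "k - 1" a] less.prems
      by (simp add: R_add fun_eq_iff)
    moreover have "int (k - 1) = int k - 1" using 3 by simp
    ultimately have "(C b n \<otimes>\<^bsub>R\<^esub> C a j) x = 2 * int j * C b n x" for x
      using 3(1) by (simp add: algebra_simps)
    then show ?thesis by blast
  qed
qed

lemma C_mult_C_n:
  assumes "i \<le> n"
  shows "C a i \<otimes>\<^bsub>R\<^esub> C b n = (\<lambda>x. 2 * int i * C b n x)"
  using assms
proof (induction i arbitrary: rule: less_induct)
  case (less i)
  have gen: "C a 1 \<otimes>\<^bsub>R\<^esub> C b n = C b n \<oplus>\<^bsub>R\<^esub> C b n" for a
    using generator_mult_left(1)[of n a] C_n[of b a] by simp
  consider "i = 0" | "i = 1" | k where "i = Suc k" "0 < k" "k < n"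
    using less.prems by (cases i) auto
  then show ?case
  proof cases
    case 1
    then show ?thesis by (simp, simp add: R_zero)
  next
    case 2
    then show ?thesis using gen[of a] by (simp add: R_add fun_eq_iff)
  next
    case 3
    have "C a i \<otimes>\<^bsub>R\<^esub> C b n \<oplus>\<^bsub>R\<^esub> C a (k - 1) \<otimes>\<^bsub>R\<^esub> C b n =
        C a k \<otimes>\<^bsub>R\<^esub> C (flip (other_end a k)) 1 \<otimes>\<^bsub>R\<^esub> C b n"
      using 3 by (simp add: generator_mult_right R.l_distr)
    also have "\<dots> = C a k \<otimes>\<^bsub>R\<^esub> C b n \<oplus>\<^bsub>R\<^esub> C a k \<otimes>\<^bsub>R\<^esub> C b n"
      by (simp add: gen R.m_assoc R.r_distr)
    finally have "(C a i \<otimes>\<^bsub>R\<^esub> C b n) x + 2 * int (k - 1) * C b n x = 4 * int k * C b n x" for x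
      using 3 less.IH[of k] less.IH[of "k - 1"] less.prems
      by (simp add: R_add fun_eq_iff)
    moreover have "int (k - 1) = int k - 1" using 3 by simp
    ultimately have "(C a i \<otimes>\<^bsub>R\<^esub> C b n) x = 2 * int i * C b n x" for x
      using 3(1) by (simp add: algebra_simps)
    then show ?thesis by blast
  qed
qed

section \<open>Non-negativity of the structure constants\<close>

text \<open>The reduced words of the two factors meet in the same letter.\<close>

definition matched :: "letter \<Rightarrow> nat \<Rightarrow> nat \<Rightarrow> letter list set \<Rightarrow> int" where
  "matched a i j = C a i \<otimes>\<^bsub>R\<^esub> C (other_end a i) j"

lemma matched_closed [simp]: "matched a i j \<in> carrier R"
  by (simp add: matched_def)

lemma matched_boundary:
  "matched a 0 j = \<zero>\<^bsub>R\<^esub>" "matched a i 0 = \<zero>\<^bsub>R\<^esub>"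
  "i \<le> n \<Longrightarrow> matched a i 1 = C a i \<oplus>\<^bsub>R\<^esub> C a i"
  "j \<le> n \<Longrightarrow> matched a 1 j = C a j \<oplus>\<^bsub>R\<^esub> C a j"
  using generator_mult_left(1)[of j a] generator_mult_right(1)[of i a]
  by (auto simp: matched_def other_end_def)

text \<open>
  If the words meet in different letters, inserting the last letter of the first word or the
  first letter of the second one doubles the product. The two ways of evaluating the result
  give a discrete wave equation.
\<close>

lemma double_mismatched:
  fixes a :: letter
  assumes "0 < i" "i < n" "0 < j" "j < n"
  defines "v \<equiv> C a i \<otimes>\<^bsub>R\<^esub> C (flip (other_end a i)) j"
  shows "v \<oplus>\<^bsub>R\<^esub> v = matched a (Suc i) j \<oplus>\<^bsub>R\<^esub> matched a (i - 1) j"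
    and "v \<oplus>\<^bsub>R\<^esub> v = matched a i (Suc j) \<oplus>\<^bsub>R\<^esub> matched a i (j - 1)"
proof -
  let ?o = "other_end a i"
  obtain i' where i': "i = Suc i'" using assms(1) by (cases i) auto
  have "v \<oplus>\<^bsub>R\<^esub> v = C a i \<otimes>\<^bsub>R\<^esub> C (flip ?o) 1 \<otimes>\<^bsub>R\<^esub> C (flip ?o) j"
    using assms generator_mult_left(1)[of j "flip ?o"] by (simp add: v_def R.m_assoc R.r_distr)
  also have "\<dots> = matched a (Suc i) j \<oplus>\<^bsub>R\<^esub> matched a (i - 1) j"
    using assms generator_mult_right(2)[of i a]
    by (simp add: matched_def R.l_distr other_end_Suc) (simp add: i' other_end_Suc)
  finally show "v \<oplus>\<^bsub>R\<^esub> v = matched a (Suc i) j \<oplus>\<^bsub>R\<^esub> matched a (i - 1) j" .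
  have "v \<oplus>\<^bsub>R\<^esub> v = C a i \<otimes>\<^bsub>R\<^esub> C ?o 1 \<otimes>\<^bsub>R\<^esub> C (flip ?o) j"
    using assms generator_mult_right(1)[of i a] by (simp add: v_def R.l_distr)
  also have "\<dots> = matched a i (Suc j) \<oplus>\<^bsub>R\<^esub> matched a i (j - 1)"
    using assms generator_mult_left(2)[of j ?o] by (simp add: matched_def R.m_assoc R.r_distr)
  finally show "v \<oplus>\<^bsub>R\<^esub> v = matched a i (Suc j) \<oplus>\<^bsub>R\<^esub> matched a i (j - 1)" .
qed

lemma matched_wave:
  assumes "0 < i" "i < n" "0 < j" "j < n"
  shows "matched a (Suc i) j x + matched a (i - 1) j x = matched a i (Suc j) x + matched a i (j - 1) x"
  using double_mismatched[OF assms, of a] by (auto simp: R_add fun_eq_iff)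

text \<open>
  The wave equation propagates the boundary values at \<open>0\<close> and \<open>1\<close>, so the product changes along an
  antidiagonal by a single term. Moving away from the main diagonal, until one factor has length \<open>n\<close>
  and the product is a multiple of the longest element, this term is never subtracted. The usual
  Clebsch-Gordan recursion goes the other way and has to be corrected once \<open>i + j > n\<close>.
\<close>

lemma matched_diagonal_lower:
  assumes "j \<le> i" "i < n"
  shows "matched a i (Suc j) x = matched a (Suc i) j x + 2 * C a (i - j) x"
  using assms
proof (induction j arbitrary: i)
  case 0
  then show ?case using matched_boundary(2)[of a "Suc i"] matched_boundary(3)[of i a]
    by (simp add: R_add R_zero One_nat_def)
next
  case (Suc j)
  obtain i' where i': "i = Suc i'" using Suc.prems by (cases i) auto
  show ?case
    using matched_wave[of i "Suc j" a x] Suc.IH[of i'] Suc.prems by (simp add: i')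
qed

lemma matched_diagonal_upper:
  assumes "i \<le> j" "j < n"
  shows "matched a (Suc i) j x = matched a i (Suc j) x + 2 * C a (j - i) x"
  using assms
proof (induction i arbitrary: j)
  case 0
  then show ?case using matched_boundary(1)[of a "Suc j"] matched_boundary(4)[of j a]
    by (simp add: R_add R_zero One_nat_def)
next
  case (Suc i)
  obtain j' where j': "j = Suc j'" using Suc.prems by (cases j) auto
  show ?case
    using matched_wave[of "Suc i" j a x] Suc.IH[of j'] Suc.prems by (simp add: j')
qed

text \<open>
  The span of the right cell of \<open>a\<close> and the longest element, which is reached as \<open>C a n\<close>.
\<close>

inductive_set span :: "letter \<Rightarrow> (letter list set \<Rightarrow> int) set" for a where
  span_zero: "\<zero>\<^bsub>R\<^esub> \<in> span a"
| span_C: "k \<le> n \<Longrightarrow> C a k \<in> span a"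
| span_add: "f \<in> span a \<Longrightarrow> g \<in> span a \<Longrightarrow> f \<oplus>\<^bsub>R\<^esub> g \<in> span a"

lemma span_multiple_C_n: "(\<lambda>x. int m * C b n x) \<in> span a"
proof (induction m)
  case 0
  then show ?case using span_zero[of a] by (simp add: R_zero)
next
  case (Suc m)
  then show ?case
    using span_add[OF Suc span_C[of n a]] C_n[of a b] by (simp add: R_add algebra_simps)
qed

text \<open>
  A matched product is twice another element because the shared letter is a generator \<open>C b 1\<close> whose
  square is its double; halving it here avoids dividing coefficients for the mismatched products.
\<close>

lemma matched_half_span:
  assumes "i \<le> n" "j \<le> n"
  shows "\<exists>h\<in>span a. matched a i j = h \<oplus>\<^bsub>R\<^esub> h"
proof (cases "j \<le> i")
  case True
  then show ?thesis using assms
  proof (induction j arbitrary: i)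
    case 0
    then show ?case using matched_boundary(2) span_zero by (intro bexI[of _ "\<zero>\<^bsub>R\<^esub>"]) auto
  next
    case (Suc j)
    show ?case
    proof (cases "i = n")
      case True
      have "matched a i (Suc j) = (\<lambda>x. int (Suc j) * C a n x) \<oplus>\<^bsub>R\<^esub> (\<lambda>x. int (Suc j) * C a n x)"
        using Suc.prems True unfolding matched_def by (simp add: C_n_mult_C R_add algebra_simps)
      then show ?thesis using span_multiple_C_n by blast
    next
      case False
      then obtain h where h: "h \<in> span a" "matched a (Suc i) j = h \<oplus>\<^bsub>R\<^esub> h"
        using Suc.IH[of "Suc i"] Suc.prems by auto
      then have "matched a i (Suc j) = (h \<oplus>\<^bsub>R\<^esub> C a (i - j)) \<oplus>\<^bsub>R\<^esub> (h \<oplus>\<^bsub>R\<^esub> C a (i - j))"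
        using matched_diagonal_lower[of j i a] False Suc.prems by (simp add: R_add fun_eq_iff)
      moreover have "h \<oplus>\<^bsub>R\<^esub> C a (i - j) \<in> span a"
        using h Suc.prems by (intro span_add span_C) auto
      ultimately show ?thesis by blast
    qed
  qed
next
  case False
  then have "i \<le> j" by simp
  then show ?thesis using assms
  proof (induction i arbitrary: j)
    case 0
    then show ?case using matched_boundary(1) span_zero by (intro bexI[of _ "\<zero>\<^bsub>R\<^esub>"]) auto
  next
    case (Suc i)
    show ?case
    proof (cases "j = n")
      case True
      have "matched a (Suc i) j = (\<lambda>x. int (Suc i) * C a n x) \<oplus>\<^bsub>R\<^esub> (\<lambda>x. int (Suc i) * C a n x)"
        using Suc.prems True C_n[of "other_end a (Suc i)" a] unfolding matched_def
        by (simp add: C_mult_C_n R_add algebra_simps)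
      then show ?thesis using span_multiple_C_n by blast
    next
      case False
      then obtain h where h: "h \<in> span a" "matched a i (Suc j) = h \<oplus>\<^bsub>R\<^esub> h"
        using Suc.IH[of "Suc j"] Suc.prems by auto
      then have "matched a (Suc i) j = (h \<oplus>\<^bsub>R\<^esub> C a (j - i)) \<oplus>\<^bsub>R\<^esub> (h \<oplus>\<^bsub>R\<^esub> C a (j - i))"
        using matched_diagonal_upper[of i j a] False Suc.prems by (simp add: R_add fun_eq_iff)
      moreover have "h \<oplus>\<^bsub>R\<^esub> C a (j - i) \<in> span a"
        using h Suc.prems by (intro span_add span_C) auto
      ultimately show ?thesis by blast
    qed
  qed
qed

lemma matched_half_span_strict:
  assumes "0 < i" "i < n" "0 < j" "j < n"
  obtains k h where "0 < k" "k < n" "h \<in> span a"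
    "matched a i j = (C a k \<oplus>\<^bsub>R\<^esub> h) \<oplus>\<^bsub>R\<^esub> (C a k \<oplus>\<^bsub>R\<^esub> h)"
proof (cases "j \<le> i")
  case True
  obtain j' where j': "j = Suc j'" using assms by (cases j) auto
  obtain h where h: "h \<in> span a" "matched a (Suc i) j' = h \<oplus>\<^bsub>R\<^esub> h"
    using matched_half_span[of "Suc i" j' a] assms j' by auto
  then have "matched a i j = (C a (i - j') \<oplus>\<^bsub>R\<^esub> h) \<oplus>\<^bsub>R\<^esub> (C a (i - j') \<oplus>\<^bsub>R\<^esub> h)"
    using matched_diagonal_lower[of j' i a] True assms j' by (simp add: R_add fun_eq_iff)
  then show thesis using that[of "i - j'" h] h True assms j' by simp
next
  case False
  obtain i' where i': "i = Suc i'" using assms by (cases i) auto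
  obtain h where h: "h \<in> span a" "matched a i' (Suc j) = h \<oplus>\<^bsub>R\<^esub> h"
    using matched_half_span[of i' "Suc j" a] assms i' by auto
  then have "matched a i j = (C a (j - i') \<oplus>\<^bsub>R\<^esub> h) \<oplus>\<^bsub>R\<^esub> (C a (j - i') \<oplus>\<^bsub>R\<^esub> h)"
    using matched_diagonal_upper[of i' j a] False assms i' by (simp add: R_add fun_eq_iff)
  then show thesis using that[of "j - i'" h] h False assms i' by simp
qed

text \<open>
  The cell of the left factor contributes at least one term. In the mismatched case twice the
  product is the sum of two matched products, by \<open>double_mismatched\<close>.
\<close>

lemma C_mult_C:
  assumes "0 < i" "i < n" "0 < j" "j < n"
  obtains k h where "0 < k" "k < n" "h \<in> span a" "C a i \<otimes>\<^bsub>R\<^esub> C b j = C a k \<oplus>\<^bsub>R\<^esub> h"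
proof (cases "b = other_end a i")
  case True
  obtain k h where k: "0 < k" "k < n" "h \<in> span a"
      "matched a i j = (C a k \<oplus>\<^bsub>R\<^esub> h) \<oplus>\<^bsub>R\<^esub> (C a k \<oplus>\<^bsub>R\<^esub> h)"
    using matched_half_span_strict[OF assms] by metis
  then have "C a i \<otimes>\<^bsub>R\<^esub> C b j = C a k \<oplus>\<^bsub>R\<^esub> (h \<oplus>\<^bsub>R\<^esub> (C a k \<oplus>\<^bsub>R\<^esub> h))"
    by (simp add: True matched_def R_add fun_eq_iff)
  moreover have "h \<oplus>\<^bsub>R\<^esub> (C a k \<oplus>\<^bsub>R\<^esub> h) \<in> span a"
    using k by (intro span_add span_C) auto
  ultimately show thesis using that k by blast
next
  case False
  then have b: "b = flip (other_end a i)" by (simp add: neq_iff_flip[symmetric])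
  \<comment> \<open>One of the two neighbours of \<open>i\<close> lies strictly between \<open>0\<close> and \<open>n\<close>.\<close>
  obtain i1 i2 where i12: "{i1, i2} = {i - 1, Suc i}" "0 < i1" "i1 < n" "i2 \<le> n"
  proof (cases "i = 1")
    case True
    then show thesis using that[of "Suc i" "i - 1"] n_ge_3 by auto
  next
    case False
    then show thesis using that[of "i - 1" "Suc i"] assms by auto
  qed
  obtain k h where k: "0 < k" "k < n" "h \<in> span a"
      "matched a i1 j = (C a k \<oplus>\<^bsub>R\<^esub> h) \<oplus>\<^bsub>R\<^esub> (C a k \<oplus>\<^bsub>R\<^esub> h)"
    using matched_half_span_strict[OF i12(2,3) assms(3,4)] by metis
  obtain h' where h': "h' \<in> span a" "matched a i2 j = h' \<oplus>\<^bsub>R\<^esub> h'"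
    using matched_half_span[of i2 j a] i12 assms by auto
  have double: "(C a i \<otimes>\<^bsub>R\<^esub> C b j) x + (C a i \<otimes>\<^bsub>R\<^esub> C b j) x = matched a i1 j x + matched a i2 j x" for x
    using double_mismatched(1)[OF assms, of a] i12(1)
    by (auto simp: b R_add fun_eq_iff doubleton_eq_iff)
  have "C a i \<otimes>\<^bsub>R\<^esub> C b j = C a k \<oplus>\<^bsub>R\<^esub> (h \<oplus>\<^bsub>R\<^esub> h')"
  proof
    fix x
    show "(C a i \<otimes>\<^bsub>R\<^esub> C b j) x = (C a k \<oplus>\<^bsub>R\<^esub> (h \<oplus>\<^bsub>R\<^esub> h')) x"
      using double[of x] k(4) h'(2) by (simp add: R_add)
  qed
  moreover have "h \<oplus>\<^bsub>R\<^esub> h' \<in> span a"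
    using k h' by (intro span_add) auto
  ultimately show thesis using that k by blast
qed


inductive_set nonneg_span :: "(letter list set \<Rightarrow> int) set" where
  nonneg_zero: "\<zero>\<^bsub>R\<^esub> \<in> nonneg_span"
| nonneg_kl: "w \<in> carrier (dihedral n) \<Longrightarrow> kl n w \<in> nonneg_span"
| nonneg_add: "f \<in> nonneg_span \<Longrightarrow> g \<in> nonneg_span \<Longrightarrow> f \<oplus>\<^bsub>R\<^esub> g \<in> nonneg_span"

lemma nonneg_span_C: "C a k \<in> nonneg_span"
  by (simp add: C_def nonneg_zero nonneg_kl)

lemma span_subset_nonneg_span: "f \<in> span a \<Longrightarrow> f \<in> nonneg_span"
  by (induction rule: span.induct) (auto intro: nonneg_zero nonneg_add nonneg_span_C)

lemma nonneg_span_closed: "f \<in> nonneg_span \<Longrightarrow> f \<in> carrier R"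
  by (induction rule: nonneg_span.induct) auto

lemma kl_cases:
  assumes "w \<in> carrier (dihedral n)"
  obtains "w = \<one>\<^bsub>dihedral n\<^esub>" "kl n w = \<one>\<^bsub>R\<^esub>"
  | a k where "0 < k" "k < n" "w = wd n a k" "kl n w = C a k"
  | "w = longest n" "kl n w = C S n"
proof -
  obtain a k where w: "k \<le> n" "w = wd n a k" using wd_cases[OF n_pos assms] .
  show thesis
  proof (cases "k = 0 \<or> k = n")
    case False
    then show thesis using that(2)[of k a] w by (auto simp: C_def)
  next
    case True
    then show thesis
      using that(1,3) w R_one[of a] n_pos C_n[of a S] by (auto simp: wd_0 wd_n C_def)
  qed
qed

lemma kl_mult_nonneg:
  assumes "v \<in> carrier (dihedral n)" "w \<in> carrier (dihedral n)"
  shows "kl n v \<otimes>\<^bsub>R\<^esub> kl n w \<in> nonneg_span"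
proof -
  have multiple: "(\<lambda>x. 2 * int j * C b n x) \<in> nonneg_span" for j b
    using span_subset_nonneg_span[OF span_multiple_C_n[of "2 * j" b S]] by simp
  have C: "C a i \<otimes>\<^bsub>R\<^esub> C b j \<in> nonneg_span" if ij: "0 < i" "i \<le> n" "0 < j" "j \<le> n" for a b i j
  proof (cases "i = n \<or> j = n")
    case True
    then show ?thesis using ij multiple C_n_mult_C C_mult_C_n by auto
  next
    case False
    then obtain k h where "h \<in> span a" "C a i \<otimes>\<^bsub>R\<^esub> C b j = C a k \<oplus>\<^bsub>R\<^esub> h"
      using C_mult_C[of i j a b] ij by (metis le_neq_implies_less)
    then show ?thesis by (simp add: nonneg_add nonneg_span_C span_subset_nonneg_span)
  qed
  have "kl n u = \<one>\<^bsub>R\<^esub> \<or> (\<exists>a k. 0 < k \<and> k \<le> n \<and> kl n u = C a k)" if "u \<in> carrier (dihedral n)" for u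
    using that by (rule kl_cases) (use n_pos in \<open>auto intro: less_imp_le\<close>)
  then show ?thesis
    using assms C nonneg_kl by (metis R.l_one R.r_one kl_closed)
qed

lemma carrier_eq_nonneg_span: "carrier R = nonneg_span"
proof (intro equalityI subsetI)
  have kl_l: "kl n v \<otimes>\<^bsub>R\<^esub> g \<in> nonneg_span" if "g \<in> nonneg_span" "v \<in> carrier (dihedral n)" for v g
    using that(1)
    by induction (use that(2) in \<open>simp_all add: nonneg_zero nonneg_add kl_mult_nonneg R.r_distr nonneg_span_closed\<close>)
  have mult: "f \<otimes>\<^bsub>R\<^esub> g \<in> nonneg_span" if "f \<in> nonneg_span" "g \<in> nonneg_span" for f g
    using that(1)
    by induction (use that(2) in \<open>simp_all add: nonneg_zero nonneg_add kl_l R.l_distr nonneg_span_closed\<close>)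
  have ops: "\<zero>\<^bsub>group_ring (dihedral n)\<^esub> = \<zero>\<^bsub>R\<^esub>" "\<one>\<^bsub>group_ring (dihedral n)\<^esub> = \<one>\<^bsub>R\<^esub>"
    "f \<oplus>\<^bsub>group_ring (dihedral n)\<^esub> g = f \<oplus>\<^bsub>R\<^esub> g" "f \<otimes>\<^bsub>group_ring (dihedral n)\<^esub> g = f \<otimes>\<^bsub>R\<^esub> g" for f g
    by (simp_all add: kl_semiring_def)
  fix f assume "f \<in> carrier R"
  then show "f \<in> nonneg_span" unfolding R_carrier
  proof induction
    case one
    then show ?case using nonneg_kl[of "wd n S 0"] by (simp add: ops R_one[of S])
  qed (auto simp: ops intro: nonneg_zero nonneg_kl nonneg_add mult)
qed (simp add: nonneg_span_closed)

lemma R_induct [consumes 1, case_names zero kl add]: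
  assumes "f \<in> carrier R" "P \<zero>\<^bsub>R\<^esub>" "\<And>w. w \<in> carrier (dihedral n) \<Longrightarrow> P (kl n w)"
    "\<And>f g. f \<in> carrier R \<Longrightarrow> g \<in> carrier R \<Longrightarrow> P f \<Longrightarrow> P g \<Longrightarrow> P (f \<oplus>\<^bsub>R\<^esub> g)"
  shows "P f"
  using assms(1) unfolding carrier_eq_nonneg_span
  by induction (use assms in \<open>auto simp: carrier_eq_nonneg_span\<close>)

section \<open>Semimodules given by the action of the basis\<close>

lemma finite_D: "finite (carrier (dihedral n))"
  by (rule finite_dihedral[OF n_pos])

text \<open>
  The change of basis is unitriangular with respect to length, so coefficients are determined from
  the longest word downwards.
\<close>

lemma kl_independent:
  fixes e :: "letter list set \<Rightarrow> int"
  assumes "\<And>x. (\<Sum>w\<in>carrier (dihedral n). e w * kl n w x) = 0"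
  shows "k \<le> n \<Longrightarrow> e (wd n a k) = 0"
proof (induction "n - k" arbitrary: a k rule: less_induct)
  case less
  have "e w * kl n w (wd n a k) = 0" if w: "w \<in> carrier (dihedral n)" "w \<noteq> wd n a k" for w
  proof -
    obtain b j where j: "j \<le> n" "w = wd n b j" using wd_cases[OF n_pos w(1)] .
    show ?thesis
    proof (cases "k < j")
      case True
      then show ?thesis using less.hyps[of j b] j by simp
    next
      case False
      then show ?thesis using w(2) j less.prems n_pos by (auto simp: kl_wd wd_eq_iff)
    qed
  qed
  then have "(\<Sum>w\<in>carrier (dihedral n). e w * kl n w (wd n a k)) =
      (\<Sum>w\<in>{wd n a k}. e w * kl n w (wd n a k))"
    by (intro sum.mono_neutral_right) (auto simp: finite_D)
  then show ?case using assms[of "wd n a k"] less.prems n_pos by (simp add: kl_wd)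
qed

definition kl_expansion :: "(letter list set \<Rightarrow> int) \<Rightarrow> (letter list set \<Rightarrow> nat) \<Rightarrow> bool" where
  "kl_expansion r c \<longleftrightarrow> (\<forall>w. w \<notin> carrier (dihedral n) \<longrightarrow> c w = 0) \<and>
     (\<forall>x. r x = (\<Sum>w\<in>carrier (dihedral n). int (c w) * kl n w x))"

lemma kl_expansion_unique:
  assumes "kl_expansion r c" "kl_expansion r d"
  shows "c = d"
proof
  fix w
  have "(\<Sum>w\<in>carrier (dihedral n). (int (c w) - int (d w)) * kl n w x) = 0" for x
    using assms by (simp add: kl_expansion_def left_diff_distrib sum_subtractf)
  then have "int (c (wd n a k)) - int (d (wd n a k)) = 0" if "k \<le> n" for a k
    using kl_independent[of "\<lambda>w. int (c w) - int (d w)"] that by blast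
  then have wd: "c (wd n a k) = d (wd n a k)" if "k \<le> n" for a k
    using that by simp
  show "c w = d w"
  proof (cases "w \<in> carrier (dihedral n)")
    case True
    then obtain a k where "k \<le> n" "w = wd n a k" using wd_cases n_pos by blast
    then show ?thesis using wd by simp
  next
    case False
    then show ?thesis using assms by (simp add: kl_expansion_def)
  qed
qed

lemma kl_coeff_eqI:
  assumes "kl_expansion r c"
  shows "kl_coeff n r = c"
  unfolding kl_coeff_def kl_expansion_def[symmetric]
  using assms kl_expansion_unique by blast

lemma kl_expansion_zero: "kl_expansion \<zero>\<^bsub>R\<^esub> (\<lambda>w. 0)"
  by (simp add: kl_expansion_def R_zero)

lemma kl_expansion_kl:
  "w \<in> carrier (dihedral n) \<Longrightarrow> kl_expansion (kl n w) (\<lambda>v. if v = w then 1 else 0)"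
  using finite_D by (auto simp: kl_expansion_def if_distrib[of int] if_distrib[of "\<lambda>c. c * _"] cong: if_cong)

lemma kl_expansion_add:
  "kl_expansion r c \<Longrightarrow> kl_expansion s d \<Longrightarrow> kl_expansion (r \<oplus>\<^bsub>R\<^esub> s) (\<lambda>w. c w + d w)"
  by (simp add: kl_expansion_def R_add distrib_right sum.distrib)

lemma kl_expansion_exists:
  assumes "r \<in> carrier R"
  shows "\<exists>c. kl_expansion r c"
  using assms
  by (induction rule: R_induct) (blast intro: kl_expansion_zero kl_expansion_kl kl_expansion_add)+

lemma kl_coeff_simps:
  "kl_coeff n \<zero>\<^bsub>R\<^esub> = (\<lambda>w. 0)"
  "w \<in> carrier (dihedral n) \<Longrightarrow> kl_coeff n (kl n w) = (\<lambda>v. if v = w then 1 else 0)"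
  "r \<in> carrier R \<Longrightarrow> s \<in> carrier R \<Longrightarrow>
    kl_coeff n (r \<oplus>\<^bsub>R\<^esub> s) = (\<lambda>w. kl_coeff n r w + kl_coeff n s w)"
  using kl_coeff_eqI kl_expansion_zero kl_expansion_kl kl_expansion_add kl_expansion_exists
  by metis+

end

lemma join_monoid_simps:
  "carrier join_monoid = UNIV" "x \<oplus>\<^bsub>join_monoid\<^esub> y = sup x y" "\<zero>\<^bsub>join_monoid\<^esub> = bot"
  by (simp_all add: join_monoid_def)

lemma abelian_monoid_join: "abelian_monoid join_monoid"
  by (rule abelian_monoidI) (auto simp: join_monoid_simps sup.assoc sup.commute sup.left_commute)

lemma kl_action_simps:
  "carrier (kl_action_semimodule n act) = UNIV"
  "x \<oplus>\<^bsub>kl_action_semimodule n act\<^esub> y = sup x y"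
  "\<zero>\<^bsub>kl_action_semimodule n act\<^esub> = bot"
  by (simp_all add: kl_action_semimodule_def ring.extend_def join_monoid_simps)

context kl_dihedral
begin

lemma kl_action_smult:
  fixes act :: "letter list set \<Rightarrow> 'b::bounded_semilattice_sup_bot \<Rightarrow> 'b"
  defines "M \<equiv> kl_action_semimodule n act"
  shows "\<zero>\<^bsub>R\<^esub> \<odot>\<^bsub>M\<^esub> x = bot"
    and "w \<in> carrier (dihedral n) \<Longrightarrow> kl n w \<odot>\<^bsub>M\<^esub> x = act w x"
    and "r \<in> carrier R \<Longrightarrow> s \<in> carrier R \<Longrightarrow>
      (r \<oplus>\<^bsub>R\<^esub> s) \<odot>\<^bsub>M\<^esub> x = sup (r \<odot>\<^bsub>M\<^esub> x) (s \<odot>\<^bsub>M\<^esub> x)"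
proof -
  interpret J: abelian_monoid "join_monoid :: 'b ring" by (rule abelian_monoid_join)
  have M: "r \<odot>\<^bsub>M\<^esub> x = (\<Oplus>\<^bsub>join_monoid\<^esub>w\<in>carrier (dihedral n).
      [kl_coeff n r w] \<cdot>\<^bsub>join_monoid\<^esub> act w x)" for r x
    by (simp add: M_def kl_action_semimodule_def ring.extend_def)

  show "\<zero>\<^bsub>R\<^esub> \<odot>\<^bsub>M\<^esub> x = bot"
    unfolding M by (simp add: kl_coeff_simps J.add.nat_pow_0 join_monoid_simps(3)[symmetric])
  show "kl n w \<odot>\<^bsub>M\<^esub> x = act w x" if "w \<in> carrier (dihedral n)"
  proof -
    have "add_pow join_monoid (if v = w then 1 else 0 :: nat) (act v x) =
        (if w = v then act v x else \<zero>\<^bsub>join_monoid\<^esub>)" for v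
      using J.add.nat_pow_Suc[of 0 "act v x"] by (auto simp: One_nat_def join_monoid_simps(2,3) join_monoid_simps(1) J.add.nat_pow_0)
    then show ?thesis
      unfolding M kl_coeff_simps(2)[OF that]
      using J.finsum_singleton[OF that finite_D, of "\<lambda>v. act v x"]
      by (simp add: join_monoid_simps(1))
  qed
  show "(r \<oplus>\<^bsub>R\<^esub> s) \<odot>\<^bsub>M\<^esub> x = sup (r \<odot>\<^bsub>M\<^esub> x) (s \<odot>\<^bsub>M\<^esub> x)"
    if "r \<in> carrier R" "s \<in> carrier R"
    unfolding M kl_coeff_simps(3)[OF that] join_monoid_simps(2)[symmetric]
    by (subst J.finsum_addf[symmetric])
      (auto simp: join_monoid_simps(1) J.add.nat_pow_mult)
qed

text \<open>
  Idempotency hides multiplicities. Both in the models and in an arbitrary minimal semimodule this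
  evaluates the products in which the longest element is a factor.
\<close>

lemma additive_multiple_C_n:
  fixes \<phi> :: "(letter list set \<Rightarrow> int) \<Rightarrow> 'b"
  assumes "\<And>r s. r \<in> carrier R \<Longrightarrow> s \<in> carrier R \<Longrightarrow> \<phi> (r \<oplus>\<^bsub>R\<^esub> s) = comb (\<phi> r) (\<phi> s)"
    and "comb (\<phi> (C a n)) (\<phi> (C a n)) = \<phi> (C a n)" and "0 < m"
  shows "\<phi> (\<lambda>x. int m * C a n x) = \<phi> (C a n)"
proof -
  have "(\<lambda>x. int (Suc j) * C a n x) \<in> carrier R \<and> \<phi> (\<lambda>x. int (Suc j) * C a n x) = \<phi> (C a n)" for j
  proof (induction j)
    case (Suc j)
    have "(\<lambda>x. int (Suc (Suc j)) * C a n x) = (\<lambda>x. int (Suc j) * C a n x) \<oplus>\<^bsub>R\<^esub> C a n"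
      by (simp add: R_add algebra_simps)
    then show ?case using Suc assms by (simp only: R.a_closed C_closed simp_thms)
  qed simp
  then show ?thesis using assms(3) by (metis gr0_implies_Suc)
qed

text \<open>
  The three families of basis elements act through \<open>id\<close>, \<open>f\<close> and \<open>g\<close>. A product of two elements
  of the middle family always involves an element of the cell of the left factor, and the rest is
  absorbed; idempotency of addition makes the multiplicities irrelevant.
\<close>

lemma semimodule_kl_action:
  fixes act :: "letter list set \<Rightarrow> 'b::bounded_semilattice_sup_bot \<Rightarrow> 'b"
  assumes act_one: "\<And>x. act \<one>\<^bsub>dihedral n\<^esub> x = x"
    and act_mid: "\<And>a k x. 0 < k \<Longrightarrow> k < n \<Longrightarrow> act (wd n a k) x = f a x"
    and act_longest: "\<And>x. act (longest n) x = g x"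
    and f_hom: "\<And>a. f a bot = bot" "\<And>a x y. f a (sup x y) = sup (f a x) (f a y)"
    and g_hom: "g bot = bot" "\<And>x y. g (sup x y) = sup (g x) (g y)"
    and fg: "\<And>a b x. f a (f b x) = f a x" "\<And>a x. f a (g x) = g x" "\<And>a x. g (f a x) = g x"
      "\<And>x. g (g x) = g x" "\<And>a x. sup (f a x) (g x) = f a x"
  shows "semimodule R (kl_action_semimodule n act)"
proof -
  define M where "M = kl_action_semimodule n act"
  note sm = kl_action_smult[where act = act, folded M_def]
  note M_simps = kl_action_simps[where n = n and act = act, folded M_def]
  have kl_hom: "act w bot = bot" "act w (sup x y) = sup (act w x) (act w y)"
    if "w \<in> carrier (dihedral n)" for w x y
    using that by (cases rule: kl_cases; simp add: act_one act_mid act_longest f_hom g_hom)+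
  have bot: "r \<odot>\<^bsub>M\<^esub> bot = bot" if "r \<in> carrier R" for r
    using that by (induction rule: R_induct) (simp_all add: sm kl_hom)
  have sup: "r \<odot>\<^bsub>M\<^esub> sup x y = sup (r \<odot>\<^bsub>M\<^esub> x) (r \<odot>\<^bsub>M\<^esub> y)" if "r \<in> carrier R" for r x y
    using that by (induction rule: R_induct) (simp_all add: sm kl_hom sup.assoc sup.left_commute)
  have C: "C a k \<odot>\<^bsub>M\<^esub> x = f a x" if "0 < k" "k < n" for a k x
    using that sm(2)[of "wd n a k"] by (simp add: C_def act_mid)
  have C_n: "C a n \<odot>\<^bsub>M\<^esub> x = g x" for a x
    using n_pos sm(2)[OF wd_in_carrier[of n a n]] by (simp add: C_def wd_n act_longest)
  have one: "\<one>\<^bsub>R\<^esub> \<odot>\<^bsub>M\<^esub> x = x" for x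
    using sm(2)[of "wd n S 0"] by (simp add: R_one[of S] act_one wd_0)
  have span: "h \<in> carrier R \<and> sup (f a x) (h \<odot>\<^bsub>M\<^esub> x) = f a x" if "h \<in> span a" for h a x
    using that
  proof induction
    case (span_C k)
    then show ?case
      using C[of k a x] C_n[of a x] fg(5)[of a x] sm(1)[of x]
      by (cases "k = 0 \<or> k = n") auto
  next
    case (span_add h h')
    have "h \<in> carrier R" "h' \<in> carrier R" using span_add.IH by blast+
    then have "sup (f a x) ((h \<oplus>\<^bsub>R\<^esub> h') \<odot>\<^bsub>M\<^esub> x) =
        sup (sup (f a x) (h \<odot>\<^bsub>M\<^esub> x)) (h' \<odot>\<^bsub>M\<^esub> x)"
      by (simp only: sm(3) sup.assoc)
    then show ?case using span_add.IH by simp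
  qed (simp add: sm(1))
  have multiple: "(\<lambda>y. 2 * int k * C a n y) \<odot>\<^bsub>M\<^esub> x = g x" if "0 < k" for k a x
    using additive_multiple_C_n[of "\<lambda>r. r \<odot>\<^bsub>M\<^esub> x" sup a "2 * k"] that by (simp add: sm(3) C_n)
  have kl_assoc: "(kl n v \<otimes>\<^bsub>R\<^esub> kl n w) \<odot>\<^bsub>M\<^esub> x = kl n v \<odot>\<^bsub>M\<^esub> (kl n w \<odot>\<^bsub>M\<^esub> x)"
    if v: "v \<in> carrier (dihedral n)" and w: "w \<in> carrier (dihedral n)" for v w x
    using v
  proof (cases rule: kl_cases)
    case 1
    then show ?thesis using w by (simp add: one)
  next
    case v': (2 a i)
    show ?thesis using w
    proof (cases rule: kl_cases)
      case 1
      then show ?thesis using v by (simp add: one)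
    next
      case w': (2 b j)
      obtain k h where k: "0 < k" "k < n" "h \<in> span a" "C a i \<otimes>\<^bsub>R\<^esub> C b j = C a k \<oplus>\<^bsub>R\<^esub> h"
        using C_mult_C[OF v'(1,2) w'(1,2)] by metis
      then show ?thesis
        using v' w' span by (simp add: sm(3) C fg)
    next
      case 3
      then show ?thesis using v' by (simp add: C_mult_C_n multiple C C_n fg)
    qed
  next
    case v': 3
    show ?thesis using w
    proof (cases rule: kl_cases)
      case 1
      then show ?thesis using v by (simp add: one)
    next
      case (2 b j)
      then show ?thesis using v' by (simp add: C_n_mult_C multiple C C_n fg)
    next
      case 3
      then show ?thesis using v' n_pos by (simp add: C_n_mult_C multiple C_n fg)
    qed
  qed
  have kl_assoc': "(kl n v \<otimes>\<^bsub>R\<^esub> s) \<odot>\<^bsub>M\<^esub> x = kl n v \<odot>\<^bsub>M\<^esub> (s \<odot>\<^bsub>M\<^esub> x)"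
    if "v \<in> carrier (dihedral n)" "s \<in> carrier R" for v s x
    using that(2,1)
    by (induction rule: R_induct) (simp_all add: sm(1,3) bot sup kl_assoc R.r_distr)
  have assoc: "(r \<otimes>\<^bsub>R\<^esub> s) \<odot>\<^bsub>M\<^esub> x = r \<odot>\<^bsub>M\<^esub> (s \<odot>\<^bsub>M\<^esub> x)"
    if "r \<in> carrier R" "s \<in> carrier R" for r s x
    using that
    by (induction rule: R_induct) (simp_all add: sm(1,3) bot kl_assoc' R.l_distr)
  have "abelian_monoid M"
    by (rule abelian_monoidI) (auto simp: M_simps sup.assoc sup.commute sup.left_commute)
  then have "semimodule R M"
    by (intro semimodule.intro semimodule_axioms.intro)
      (simp_all add: M_simps R.semiring_axioms sm bot sup assoc one)
  then show ?thesis by (simp add: M_def)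
qed

end

section \<open>Images, quotients and minimality of semimodules\<close>

definition semimodule_epi ::
    "('a, 'c) ring_scheme \<Rightarrow> ('a, 'b, 'd) module_scheme \<Rightarrow> ('a, 'e, 'f) module_scheme \<Rightarrow> ('b \<Rightarrow> 'e) set"
  where
  "semimodule_epi R M N = {h. h ` carrier M = carrier N \<and> h \<zero>\<^bsub>M\<^esub> = \<zero>\<^bsub>N\<^esub> \<and>
     (\<forall>x\<in>carrier M. \<forall>y\<in>carrier M. h (x \<oplus>\<^bsub>M\<^esub> y) = h x \<oplus>\<^bsub>N\<^esub> h y) \<and>
     (\<forall>a\<in>carrier R. \<forall>x\<in>carrier M. h (a \<odot>\<^bsub>M\<^esub> x) = a \<odot>\<^bsub>N\<^esub> h x)}"

lemma semimodule_epiD: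
  assumes "h \<in> semimodule_epi R M N"
  shows "carrier N = h ` carrier M" "\<zero>\<^bsub>N\<^esub> = h \<zero>\<^bsub>M\<^esub>"
    "\<And>x y. x \<in> carrier M \<Longrightarrow> y \<in> carrier M \<Longrightarrow> h x \<oplus>\<^bsub>N\<^esub> h y = h (x \<oplus>\<^bsub>M\<^esub> y)"
    "\<And>a x. a \<in> carrier R \<Longrightarrow> x \<in> carrier M \<Longrightarrow> a \<odot>\<^bsub>N\<^esub> h x = h (a \<odot>\<^bsub>M\<^esub> x)"
  using assms by (auto simp: semimodule_epi_def)

lemma semimodule_image:
  assumes "semimodule R M" "h \<in> semimodule_epi R M N"
  shows "semimodule R N"
proof -
  interpret semimodule R M by fact
  note h = semimodule_epiD[OF assms(2)]
  have "abelian_monoid N"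
    by (rule abelian_monoidI) (auto simp: h M.a_ac)
  then show ?thesis
    by (intro semimodule.intro semimodule_axioms.intro)
      (auto simp: h R.semiring_axioms smult_r_distr smult_r_null smult_l_distr smult_assoc
        smult_l_null smult_one)
qed

text \<open>The preimage of a subsemimodule is a subsemimodule.\<close>

lemma minimal_semimodule_image:
  assumes M: "minimal_semimodule R M" and h': "h \<in> semimodule_epi R M N"
    and nonzero: "carrier N \<noteq> {\<zero>\<^bsub>N\<^esub>}"
  shows "minimal_semimodule R N"
proof -
  interpret semimodule R M using M by (simp add: minimal_semimodule_def)
  note h = semimodule_epiD[OF h']
  have "H = {\<zero>\<^bsub>N\<^esub>} \<or> H = carrier N" if H: "subsemimodule H R N" for H
  proof -
    let ?P = "{x \<in> carrier M. h x \<in> H}"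
    have sub: "H \<subseteq> carrier N" "\<zero>\<^bsub>N\<^esub> \<in> H"
      and add: "\<And>x y. x \<in> H \<Longrightarrow> y \<in> H \<Longrightarrow> x \<oplus>\<^bsub>N\<^esub> y \<in> H"
      and smult: "\<And>a x. a \<in> carrier R \<Longrightarrow> x \<in> H \<Longrightarrow> a \<odot>\<^bsub>N\<^esub> x \<in> H"
      using H by (auto simp: subsemimodule_def submonoid_def)
    have "subsemimodule ?P R M"
      using sub add smult
      by (auto simp: subsemimodule_def submonoid_def h(3,4)[symmetric] h(2)[symmetric])
    then have "?P = {\<zero>\<^bsub>M\<^esub>} \<or> ?P = carrier M"
      using M by (auto simp: minimal_semimodule_def)
    moreover have "H = h ` ?P" using sub(1) h(1) by auto
    ultimately show ?thesis using h(1,2) by auto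
  qed
  then show ?thesis
    using semimodule_image[OF semimodule_axioms h'] nonzero by (simp add: minimal_semimodule_def)
qed

definition idempotent_monoid :: "('a, 'b, 'd) module_scheme \<Rightarrow> bool" where
  "idempotent_monoid M \<longleftrightarrow> (\<forall>x\<in>carrier M. x \<oplus>\<^bsub>M\<^esub> x = x)"

lemma idempotent_monoid_image:
  "idempotent_monoid M \<Longrightarrow> h \<in> semimodule_epi R M N \<Longrightarrow> idempotent_monoid N"
  by (auto simp: idempotent_monoid_def semimodule_epiD)

lemma idempotent_imp_proper:
  assumes "semimodule R M" "idempotent_monoid M" "carrier M \<noteq> {\<zero>\<^bsub>M\<^esub>}"
  shows "proper_semimodule R M"
proof -
  have False if "abelian_group M"
  proof -
    interpret abelian_group M by fact
    have "x = \<zero>\<^bsub>M\<^esub>" if x: "x \<in> carrier M" for x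
      using assms(2) x by (simp add: idempotent_monoid_def add.l_cancel_one)
    then show False using assms(3) zero_closed by blast
  qed
  then show ?thesis using assms(1) by (auto simp: proper_semimodule_def)
qed

text \<open>
  The isomorphism takes any preimage of an element along \<open>h\<close> and applies \<open>g\<close>. The four-element
  semimodule and its quotients are recognised in this way.
\<close>

lemma semimodule_isomorphic_same_fibres:
  assumes M: "semimodule R M" and h': "h \<in> semimodule_epi R M N" and g': "g \<in> semimodule_epi R M Q"
    and fib: "\<And>x y. x \<in> carrier M \<Longrightarrow> y \<in> carrier M \<Longrightarrow> h x = h y \<longleftrightarrow> g x = g y"
  shows "semimodule_isomorphic R N Q"
proof -
  interpret semimodule R M by fact
  note h = semimodule_epiD[OF h'] and g = semimodule_epiD[OF g']
  define k where "k u = g (inv_into (carrier M) h u)" for u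
  have k: "k (h x) = g x" if x: "x \<in> carrier M" for x
    using fib[OF inv_into_into[of "h x" h] x] f_inv_into_f[of "h x" h "carrier M"] x
    by (simp add: k_def)
  have "k \<in> semimodule_iso R N Q"
    by (auto simp: semimodule_iso_def h g k bij_betw_def inj_on_def image_image fib)
  then show ?thesis by (auto simp: semimodule_isomorphic_def)
qed

lemma quotient_epi:
  assumes M: "semimodule R M" and r: "equiv (carrier M) r"
    and add: "\<And>x y z. (x, y) \<in> r \<Longrightarrow> z \<in> carrier M \<Longrightarrow> (x \<oplus>\<^bsub>M\<^esub> z, y \<oplus>\<^bsub>M\<^esub> z) \<in> r"
    and smult: "\<And>a x y. a \<in> carrier R \<Longrightarrow> (x, y) \<in> r \<Longrightarrow> (a \<odot>\<^bsub>M\<^esub> x, a \<odot>\<^bsub>M\<^esub> y) \<in> r"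
  shows "(\<lambda>x. r `` {x}) \<in> semimodule_epi R M (quotient_semimodule M r)"
proof -
  interpret semimodule R M by fact
  have closed: "x \<in> carrier M \<and> y \<in> carrier M" if "(x, y) \<in> r" for x y
    using that r by (auto simp: equiv_def refl_on_def)
  have eqI: "r `` {x} = r `` {y}" if "(x, y) \<in> r" for x y
    using that r by (rule equiv_class_eq[rotated])
  have "congruent2 r r (\<lambda>x y. r `` {x \<oplus>\<^bsub>M\<^esub> y})"
  proof (rule congruent2I'[OF eqI])
    fix x x' y y' assume xy: "(x, x') \<in> r" "(y, y') \<in> r"
    have "(x \<oplus>\<^bsub>M\<^esub> y, x' \<oplus>\<^bsub>M\<^esub> y) \<in> r" using add xy closed by blast
    moreover have "(x' \<oplus>\<^bsub>M\<^esub> y, x' \<oplus>\<^bsub>M\<^esub> y') \<in> r"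
      using add[OF xy(2), of x'] closed xy by (simp add: M.a_comm)
    ultimately show "(x \<oplus>\<^bsub>M\<^esub> y, x' \<oplus>\<^bsub>M\<^esub> y') \<in> r"
      using r by (meson equiv_def transD)
  qed
  then have "(\<Union>u\<in>r `` {x}. \<Union>v\<in>r `` {y}. r `` {u \<oplus>\<^bsub>M\<^esub> v}) = r `` {x \<oplus>\<^bsub>M\<^esub> y}"
    if "x \<in> carrier M" "y \<in> carrier M" for x y
    using UN_equiv_class2[OF r r] that by blast
  moreover have "(\<Union>u\<in>r `` {x}. r `` {a \<odot>\<^bsub>M\<^esub> u}) = r `` {a \<odot>\<^bsub>M\<^esub> x}"
    if "x \<in> carrier M" "a \<in> carrier R" for x a
    using that by (intro UN_equiv_class[OF r]) (auto simp: congruent_def intro!: eqI smult)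
  ultimately show ?thesis
    by (auto simp: semimodule_epi_def quotient_semimodule_def quotient_def)
qed

section \<open>Minimal proper semimodules are idempotent\<close>

inductive_set add_hull :: "('a, 'b, 'd) module_scheme \<Rightarrow> 'b set \<Rightarrow> 'b set" for M G where
  hull_zero: "\<zero>\<^bsub>M\<^esub> \<in> add_hull M G"
| hull_incl: "x \<in> G \<Longrightarrow> x \<in> add_hull M G"
| hull_add: "x \<in> add_hull M G \<Longrightarrow> y \<in> add_hull M G \<Longrightarrow> x \<oplus>\<^bsub>M\<^esub> y \<in> add_hull M G"

context semimodule
begin

lemma add_hull_closed:
  assumes "G \<subseteq> carrier M" "x \<in> add_hull M G"
  shows "x \<in> carrier M"
  using assms(2) by induction (use assms(1) in auto)

lemma add_hull_insert:
  assumes "insert g G \<subseteq> carrier M" "x \<in> add_hull M (insert g G)"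
  shows "x \<in> add_hull M G \<or> (\<exists>y\<in>carrier M. x = g \<oplus>\<^bsub>M\<^esub> y)"
  using assms(2)
proof induction
  case hull_zero
  then show ?case by (simp add: add_hull.hull_zero)
next
  case (hull_incl x)
  then show ?case
    using assms(1) by (metis M.r_zero M.zero_closed add_hull.hull_incl insertE insert_subset)
next
  case (hull_add x y)
  have cl: "x \<in> carrier M" "y \<in> carrier M" "g \<in> carrier M"
    using hull_add.hyps add_hull_closed[OF assms(1)] assms(1) by auto
  consider z where "z \<in> carrier M" "x = g \<oplus>\<^bsub>M\<^esub> z" | z where "z \<in> carrier M" "y = g \<oplus>\<^bsub>M\<^esub> z"
    | "x \<in> add_hull M G" "y \<in> add_hull M G"
    using hull_add.IH by blast
  then show ?case
  proof cases
    case (1 z)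
    then have "x \<oplus>\<^bsub>M\<^esub> y = g \<oplus>\<^bsub>M\<^esub> (z \<oplus>\<^bsub>M\<^esub> y)" "z \<oplus>\<^bsub>M\<^esub> y \<in> carrier M"
      using cl by (auto simp: M.a_assoc)
    then show ?thesis by blast
  next
    case (2 z)
    then have "x \<oplus>\<^bsub>M\<^esub> y = g \<oplus>\<^bsub>M\<^esub> (x \<oplus>\<^bsub>M\<^esub> z)" "x \<oplus>\<^bsub>M\<^esub> z \<in> carrier M"
      using cl by (auto simp: M.a_lcomm)
    then show ?thesis by blast
  qed (auto intro: add_hull.hull_add)
qed

lemma add_hull_mono_closed:
  assumes "\<And>g. g \<in> G \<Longrightarrow> g \<in> add_hull M G'" "x \<in> add_hull M G"
  shows "x \<in> add_hull M G'"
  using assms(2) by induction (auto intro: add_hull.intros assms(1))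

text \<open>
  An element \<open>g\<close> of a minimal generating set has to occur in its own half: \<open>g = x + x\<close> with
  \<open>x = g + y\<close>, since otherwise the other generators would suffice. So \<open>g\<close> absorbs \<open>g + (y + y)\<close>, which
  is then idempotent, and it is not zero because \<open>g\<close> is not invertible.
\<close>

lemma exists_idempotent:
  assumes G: "finite G" "G \<subseteq> carrier M" "add_hull M G = carrier M"
    and nonzero: "carrier M \<noteq> {\<zero>\<^bsub>M\<^esub>}"
    and divisible: "\<And>x. x \<in> carrier M \<Longrightarrow> \<exists>y\<in>carrier M. x = y \<oplus>\<^bsub>M\<^esub> y"
    and zerosumfree: "\<And>x y. x \<in> carrier M \<Longrightarrow> y \<in> carrier M \<Longrightarrow> x \<oplus>\<^bsub>M\<^esub> y = \<zero>\<^bsub>M\<^esub> \<Longrightarrow> x = \<zero>\<^bsub>M\<^esub>"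
  shows "\<exists>e\<in>carrier M. e \<noteq> \<zero>\<^bsub>M\<^esub> \<and> e \<oplus>\<^bsub>M\<^esub> e = e"
  using G
proof (induction "card G" arbitrary: G rule: less_induct)
  case less
  have "G \<noteq> {}"
  proof
    assume "G = {}"
    have "x = \<zero>\<^bsub>M\<^esub>" if "x \<in> add_hull M {}" for x
      using that by induction auto
    then show False using less.prems(3) nonzero M.zero_closed unfolding \<open>G = {}\<close> by blast
  qed
  then obtain g where g: "g \<in> G" by blast
  define G' where "G' = G - {g}"
  have G': "G = insert g G'" "G' \<subseteq> carrier M" "finite G'" "card G' < card G"
    using g less.prems(1,2) card_Diff1_less[OF less.prems(1) g] unfolding G'_def by auto
  show ?case
  proof (cases "g \<in> add_hull M G'")
    case True
    then have "add_hull M G' = carrier M"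
      using less.prems(3) add_hull_mono_closed[of G G'] add_hull_closed[OF G'(2)] G'(1)
      by (auto intro: add_hull.hull_incl)
    then show ?thesis using less.hyps G' by blast
  next
    case False
    have gM: "g \<in> carrier M" using g less.prems(2) by blast
    then obtain x where x: "x \<in> carrier M" "g = x \<oplus>\<^bsub>M\<^esub> x" using divisible by blast
    then have "x \<notin> add_hull M G'" using False hull_add by metis
    then obtain y where y: "y \<in> carrier M" "x = g \<oplus>\<^bsub>M\<^esub> y"
      using add_hull_insert[of g G' x] less.prems x G'(1) by auto
    let ?e = "g \<oplus>\<^bsub>M\<^esub> (y \<oplus>\<^bsub>M\<^esub> y)"
    have "g \<oplus>\<^bsub>M\<^esub> ?e = (g \<oplus>\<^bsub>M\<^esub> y) \<oplus>\<^bsub>M\<^esub> (g \<oplus>\<^bsub>M\<^esub> y)" using y(1) gM by (simp add: M.a_ac)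
    then have ge: "g \<oplus>\<^bsub>M\<^esub> ?e = g" unfolding y(2)[symmetric] x(2)[symmetric] .
    have "?e \<oplus>\<^bsub>M\<^esub> ?e = g \<oplus>\<^bsub>M\<^esub> ?e \<oplus>\<^bsub>M\<^esub> (y \<oplus>\<^bsub>M\<^esub> y)"
      using y(1) gM by (simp add: M.a_ac)
    then have "?e \<oplus>\<^bsub>M\<^esub> ?e = ?e" unfolding ge .
    moreover have "?e \<noteq> \<zero>\<^bsub>M\<^esub>"
      using zerosumfree[OF gM, of "y \<oplus>\<^bsub>M\<^esub> y"] y(1) False hull_zero by auto
    moreover have "?e \<in> carrier M" using y(1) gM by simp
    ultimately show ?thesis by blast
  qed
qed

lemma minimal_subsemimodule:
  assumes "minimal_semimodule R M" "H \<subseteq> carrier M" "\<zero>\<^bsub>M\<^esub> \<in> H"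
    "\<And>x y. x \<in> H \<Longrightarrow> y \<in> H \<Longrightarrow> x \<oplus>\<^bsub>M\<^esub> y \<in> H"
    "\<And>a x. a \<in> carrier R \<Longrightarrow> x \<in> H \<Longrightarrow> a \<odot>\<^bsub>M\<^esub> x \<in> H"
  shows "H = {\<zero>\<^bsub>M\<^esub>} \<or> H = carrier M"
proof -
  have "subsemimodule H R M"
    using assms(2-) by (auto simp: subsemimodule_def submonoid_def)
  then show ?thesis using assms(1) by (auto simp: minimal_semimodule_def)
qed

text \<open>
  The invertible elements form a subsemimodule, which is not everything because \<open>M\<close> is not a group.
\<close>

lemma minimal_proper_zerosumfree:
  assumes min: "minimal_proper_semimodule R M"
    and xy: "x \<in> carrier M" "y \<in> carrier M" "x \<oplus>\<^bsub>M\<^esub> y = \<zero>\<^bsub>M\<^esub>"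
  shows "x = \<zero>\<^bsub>M\<^esub>"
proof -
  let ?U = "{x \<in> carrier M. \<exists>y\<in>carrier M. x \<oplus>\<^bsub>M\<^esub> y = \<zero>\<^bsub>M\<^esub>}"
  have add: "u \<oplus>\<^bsub>M\<^esub> v \<in> ?U" if uv: "u \<in> ?U" "v \<in> ?U" for u v
  proof -
    obtain u' v' where "u' \<in> carrier M" "u \<oplus>\<^bsub>M\<^esub> u' = \<zero>\<^bsub>M\<^esub>" "v' \<in> carrier M" "v \<oplus>\<^bsub>M\<^esub> v' = \<zero>\<^bsub>M\<^esub>"
      using uv by blast
    moreover have "(u \<oplus>\<^bsub>M\<^esub> v) \<oplus>\<^bsub>M\<^esub> (u' \<oplus>\<^bsub>M\<^esub> v') = (u \<oplus>\<^bsub>M\<^esub> u') \<oplus>\<^bsub>M\<^esub> (v \<oplus>\<^bsub>M\<^esub> v')"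
      using uv calculation by (simp add: M.a_ac)
    ultimately show ?thesis using uv by (auto intro!: bexI[of _ "u' \<oplus>\<^bsub>M\<^esub> v'"])
  qed
  have smult: "a \<odot>\<^bsub>M\<^esub> u \<in> ?U" if "a \<in> carrier R" "u \<in> ?U" for a u
  proof -
    obtain u' where u': "u' \<in> carrier M" "u \<oplus>\<^bsub>M\<^esub> u' = \<zero>\<^bsub>M\<^esub>" using \<open>u \<in> ?U\<close> by blast
    then have "a \<odot>\<^bsub>M\<^esub> u \<oplus>\<^bsub>M\<^esub> a \<odot>\<^bsub>M\<^esub> u' = \<zero>\<^bsub>M\<^esub>"
      using that by (simp add: smult_r_distr[symmetric] smult_r_null)
    then show ?thesis using that u' by auto
  qed
  have "\<not> abelian_group M" and min': "minimal_semimodule R M"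
    using min by (auto simp: minimal_proper_semimodule_def proper_semimodule_def)
  have "?U \<noteq> carrier M"
  proof
    assume U: "?U = carrier M"
    have inv: "\<exists>v\<in>carrier M. v \<oplus>\<^bsub>M\<^esub> u = \<zero>\<^bsub>M\<^esub>" if u: "u \<in> carrier M" for u
    proof -
      have "u \<in> ?U" using u unfolding U .
      then obtain v where "v \<in> carrier M" "u \<oplus>\<^bsub>M\<^esub> v = \<zero>\<^bsub>M\<^esub>" by blast
      then show ?thesis using u M.a_comm[of u v] by (intro bexI[of _ v]) simp_all
    qed
    have "abelian_group M"
      by (rule abelian_groupI) (use inv in \<open>simp_all add: M.a_ac\<close>)
    then show False using \<open>\<not> abelian_group M\<close> by blast
  qed
  moreover have "?U = {\<zero>\<^bsub>M\<^esub>} \<or> ?U = carrier M"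
    by (rule minimal_subsemimodule[OF min']) (use add smult in auto)
  ultimately have "?U = {\<zero>\<^bsub>M\<^esub>}" by blast
  then show ?thesis using xy by blast
qed

text \<open>
  Both the doubles and the idempotents form subsemimodules. The former is not zero since there are
  no invertible elements; hence \<open>M\<close> is divisible by \<open>2\<close> and the latter is not zero either.
\<close>

lemma minimal_proper_idempotent:
  assumes min: "minimal_proper_semimodule R M"
    and G: "finite G" "G \<subseteq> carrier M" "add_hull M G = carrier M"
  shows "idempotent_monoid M"
proof -
  have min': "minimal_semimodule R M" and nonzero: "carrier M \<noteq> {\<zero>\<^bsub>M\<^esub>}"
    using min by (auto simp: minimal_proper_semimodule_def minimal_semimodule_def)
  note zsf = minimal_proper_zerosumfree[OF min]
  have shuffle: "(x \<oplus>\<^bsub>M\<^esub> x) \<oplus>\<^bsub>M\<^esub> (y \<oplus>\<^bsub>M\<^esub> y) = (x \<oplus>\<^bsub>M\<^esub> y) \<oplus>\<^bsub>M\<^esub> (x \<oplus>\<^bsub>M\<^esub> y)"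
    if "x \<in> carrier M" "y \<in> carrier M" for x y
    using that by (simp add: M.a_ac)
  let ?D = "(\<lambda>x. x \<oplus>\<^bsub>M\<^esub> x) ` carrier M"
  have "?D = {\<zero>\<^bsub>M\<^esub>} \<or> ?D = carrier M"
  proof (rule minimal_subsemimodule[OF min'])
    show "\<zero>\<^bsub>M\<^esub> \<in> ?D" by (rule image_eqI[of _ _ "\<zero>\<^bsub>M\<^esub>"]) auto
    show "u \<oplus>\<^bsub>M\<^esub> v \<in> ?D" if "u \<in> ?D" "v \<in> ?D" for u v
      using that shuffle by force
    show "a \<odot>\<^bsub>M\<^esub> u \<in> ?D" if "a \<in> carrier R" "u \<in> ?D" for a u
      using that smult_r_distr by force
  qed auto
  moreover have "?D \<noteq> {\<zero>\<^bsub>M\<^esub>}"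
  proof
    assume D: "?D = {\<zero>\<^bsub>M\<^esub>}"
    then have "x = \<zero>\<^bsub>M\<^esub>" if "x \<in> carrier M" for x using zsf that by blast
    then show False using nonzero M.zero_closed by blast
  qed
  ultimately have "?D = carrier M" by blast
  then have "\<exists>y\<in>carrier M. x = y \<oplus>\<^bsub>M\<^esub> y" if "x \<in> carrier M" for x
    using that by blast
  then have "\<exists>e\<in>carrier M. e \<noteq> \<zero>\<^bsub>M\<^esub> \<and> e \<oplus>\<^bsub>M\<^esub> e = e"
    by (rule exists_idempotent[OF G nonzero _ zsf])
  then obtain e where e: "e \<in> carrier M" "e \<noteq> \<zero>\<^bsub>M\<^esub>" "e \<oplus>\<^bsub>M\<^esub> e = e"
    by blast
  let ?I = "{x \<in> carrier M. x \<oplus>\<^bsub>M\<^esub> x = x}"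
  have "?I = {\<zero>\<^bsub>M\<^esub>} \<or> ?I = carrier M"
    by (rule minimal_subsemimodule[OF min'])
      (auto simp: smult_r_distr[symmetric] shuffle[symmetric])
  then show ?thesis using e by (auto simp: idempotent_monoid_def)
qed

end

section \<open>The six semimodules\<close>

context kl_dihedral
begin

lemma wd_mid_neq:
  assumes "0 < k" "k < n"
  shows "wd n a k \<noteq> \<one>\<^bsub>dihedral n\<^esub>" "wd n a k \<noteq> longest n"
  using assms wd_eq_iff[of k n 0 a a] wd_eq_iff[of k n n a a] by (auto simp: wd_0 wd_n)

lemma one_neq_longest: "\<one>\<^bsub>dihedral n\<^esub> \<noteq> longest n"
  using wd_eq_iff[of 0 n n S S] n_pos by (simp add: wd_0 wd_n)

lemma minimal_proper_if_idempotent: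
  assumes "minimal_semimodule R M" "idempotent_monoid M"
  shows "minimal_proper_semimodule R M"
  using assms idempotent_imp_proper by (auto simp: minimal_proper_semimodule_def minimal_semimodule_def)

lemma idempotent_kl_action: "idempotent_monoid (kl_action_semimodule n act)"
  by (simp add: idempotent_monoid_def kl_action_simps)

text \<open>A subsemimodule contains the bottom element, which leaves only two candidates.\<close>

lemma minimal_proper_bool:
  fixes act :: "letter list set \<Rightarrow> bool \<Rightarrow> bool"
  assumes "semimodule R (kl_action_semimodule n act)"
  shows "minimal_proper_semimodule R (kl_action_semimodule n act)"
proof (rule minimal_proper_if_idempotent[OF _ idempotent_kl_action])
  have "H = {False} \<or> H = UNIV" if "False \<in> H" for H :: "bool set"
    using that by (cases "True \<in> H") (auto simp: set_eq_iff, (metis (full_types))+)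
  then show "minimal_semimodule R (kl_action_semimodule n act)"
    using assms
    by (auto simp: minimal_semimodule_def subsemimodule_def submonoid_def kl_action_simps)
qed

lemma semimodule_C_e: "semimodule R (C_e n)"
  unfolding C_e_def
  by (rule semimodule_kl_action[where f = "\<lambda>a m. False" and g = "\<lambda>m. False"])
    (auto simp: wd_mid_neq one_neq_longest[symmetric])

lemma semimodule_C_w0: "semimodule R (C_w0 n)"
  unfolding C_w0_def
  by (rule semimodule_kl_action[where f = "\<lambda>a m. m" and g = "\<lambda>m. m"]) auto

lemma minimal_proper_C_e: "minimal_proper_semimodule R (C_e n)"
  using minimal_proper_bool semimodule_C_e unfolding C_e_def by blast

lemma minimal_proper_C_w0: "minimal_proper_semimodule R (C_w0 n)"
  using minimal_proper_bool semimodule_C_w0 unfolding C_w0_def by blast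

definition cell_point :: "letter \<Rightarrow> point" where
  "cell_point a = (if a = S then X else Y)"

lemma C_cell_act_simps:
  "C_cell_act n \<one>\<^bsub>dihedral n\<^esub> p = {p}"
  "0 < k \<Longrightarrow> k < n \<Longrightarrow> C_cell_act n (wd n a k) p = {cell_point a}"
  "C_cell_act n (longest n) p = {}"
  using one_neq_longest wd_mid_neq[of k a] wd_mid_neq(1)[symmetric]
  by (cases p; cases a; auto simp: right_cell_wd[OF n_pos] cell_point_def wd_eq_iff)+

lemma semimodule_C_cell: "semimodule R (C_cell n)"
  unfolding C_cell_def
  by (rule semimodule_kl_action[where f = "\<lambda>a A. if A = {} then {} else {cell_point a}" and g = "\<lambda>A. {}"])
    (auto simp: C_cell_act_simps)

lemma C_cell_simps:
  "carrier (C_cell n) = UNIV" "A \<oplus>\<^bsub>C_cell n\<^esub> B = A \<union> B" "\<zero>\<^bsub>C_cell n\<^esub> = {}"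
  by (simp_all add: C_cell_def kl_action_simps)

lemmas C_cell_smult =
  kl_action_smult[where act = "\<lambda>w A. \<Union>p\<in>A. C_cell_act n w p", folded C_cell_def]

lemma C_cell_C:
  assumes "0 < k" "k < n" "A \<noteq> {}"
  shows "C a k \<odot>\<^bsub>C_cell n\<^esub> A = {cell_point a}"
  using assms by (simp add: C_cell_smult C_def C_cell_act_simps)

lemma point_set_cases:
  fixes A :: "point set"
  obtains "A = {}" | "A = {X}" | "A = {Y}" | "A = {X, Y}"
proof -
  have "A \<in> carrier (C_cell n)" by (simp add: C_cell_simps)
  then show thesis using that unfolding carrier_C_cell by blast
qed

lemma minimal_proper_C_cell: "minimal_proper_semimodule R (C_cell n)"
proof -
  have "H = {{}} \<or> H = UNIV" if H: "subsemimodule H R (C_cell n)" for H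
  proof (cases "\<exists>A\<in>H. A \<noteq> {}")
    case True
    then obtain A where A: "A \<in> H" "A \<noteq> {}" by blast
    have empty: "{} \<in> H" and add: "\<And>A B. A \<in> H \<Longrightarrow> B \<in> H \<Longrightarrow> A \<union> B \<in> H"
      and smult: "\<And>r A. r \<in> carrier R \<Longrightarrow> A \<in> H \<Longrightarrow> r \<odot>\<^bsub>C_cell n\<^esub> A \<in> H"
      using H by (auto simp: subsemimodule_def submonoid_def C_cell_simps)
    have "{cell_point a} \<in> H" for a
      using smult[OF C_closed A(1), of a 1] C_cell_C[of 1 A a] A(2) n_ge_3 by simp
    then have "{X} \<in> H" "{Y} \<in> H"
      by (metis cell_point_def, metis cell_point_def letter.distinct(1))
    then have "B \<in> H" for B
      using empty add[of "{X}" "{Y}"]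
      by (cases B rule: point_set_cases) (auto simp: insert_commute)
    then show ?thesis by blast
  next
    case False
    moreover have "{} \<in> H"
      using H by (auto simp: subsemimodule_def submonoid_def C_cell_simps)
    ultimately show ?thesis by auto
  qed
  then have "minimal_semimodule R (C_cell n)"
    using semimodule_C_cell by (auto simp: minimal_semimodule_def C_cell_simps)
  then show ?thesis
    using minimal_proper_if_idempotent idempotent_kl_action by (metis C_cell_def)
qed

text \<open>
  Identifying an up-closed set of non-empty subsets is compatible with the action, because the
  basis elements other than the identity do not distinguish non-empty sets.
\<close>

lemma identify_epi:
  assumes K: "\<And>A. A \<in> K \<Longrightarrow> A \<noteq> {}" "\<And>A B. A \<in> K \<Longrightarrow> A \<union> B \<in> K"
  shows "(\<lambda>A. identify (C_cell n) K `` {A}) \<in>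
    semimodule_epi R (C_cell n) (quotient_semimodule (C_cell n) (identify (C_cell n) K))"
proof (rule quotient_epi[OF semimodule_C_cell])
  let ?r = "identify (C_cell n) K"
  have r: "(A, B) \<in> ?r \<longleftrightarrow> A = B \<or> A \<in> K \<and> B \<in> K" for A B
    by (auto simp: identify_def C_cell_simps)
  show "equiv (carrier (C_cell n)) ?r"
    by (auto simp: equiv_def refl_on_def sym_def trans_def r C_cell_simps)
  show "(A \<oplus>\<^bsub>C_cell n\<^esub> D, B \<oplus>\<^bsub>C_cell n\<^esub> D) \<in> ?r" if "(A, B) \<in> ?r" for A B D
    using that K(2) by (auto simp: r C_cell_simps)
  fix a A B assume a: "a \<in> carrier R" and AB: "(A, B) \<in> ?r"
  note sm = C_cell_smult
  show "(a \<odot>\<^bsub>C_cell n\<^esub> A, a \<odot>\<^bsub>C_cell n\<^esub> B) \<in> ?r"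
    using a
  proof (induction rule: R_induct)
    case zero
    then show ?case by (simp add: sm(1) r)
  next
    case (kl w)
    have AB': "A = B \<or> A \<in> K \<and> B \<in> K \<and> A \<noteq> {} \<and> B \<noteq> {}"
      using AB K(1) by (auto simp: r)
    show ?case unfolding sm(2)[OF kl] r
      using kl by (cases rule: kl_cases) (use AB' in \<open>auto simp: C_cell_act_simps\<close>)
  next
    case (add f g)
    then show ?case
      using K(2)[of "f \<odot>\<^bsub>C_cell n\<^esub> A" "g \<odot>\<^bsub>C_cell n\<^esub> A"] K(2)[of "f \<odot>\<^bsub>C_cell n\<^esub> B" "g \<odot>\<^bsub>C_cell n\<^esub> B"]
        K(2)[of "g \<odot>\<^bsub>C_cell n\<^esub> A" "f \<odot>\<^bsub>C_cell n\<^esub> A"] K(2)[of "g \<odot>\<^bsub>C_cell n\<^esub> B" "f \<odot>\<^bsub>C_cell n\<^esub> B"]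
      by (auto simp: sm(3) r Un_commute)
  qed
qed

lemma minimal_proper_identify:
  assumes K: "\<And>A. A \<in> K \<Longrightarrow> A \<noteq> {}" "\<And>A B. A \<in> K \<Longrightarrow> A \<union> B \<in> K"
  shows "minimal_proper_semimodule R (quotient_semimodule (C_cell n) (identify (C_cell n) K))"
proof (rule minimal_proper_if_idempotent)
  let ?r = "identify (C_cell n) K" and ?Q = "quotient_semimodule (C_cell n) (identify (C_cell n) K)"
  have epi: "(\<lambda>A. ?r `` {A}) \<in> semimodule_epi R (C_cell n) ?Q"
    using identify_epi K by blast
  have "{} \<in> ?r `` {{}}" "{} \<notin> ?r `` {{X}}"
    using K(1) by (auto simp: C_cell_simps identify_def)
  then have "?r `` {{X}} \<noteq> \<zero>\<^bsub>?Q\<^esub>"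
    unfolding semimodule_epiD(2)[OF epi] C_cell_simps by metis
  moreover have "?r `` {{X}} \<in> carrier ?Q"
    unfolding semimodule_epiD(1)[OF epi] C_cell_simps by blast
  ultimately show "minimal_semimodule R ?Q"
    using minimal_semimodule_image[OF _ epi] minimal_proper_C_cell
    by (auto simp: minimal_proper_semimodule_def)
  show "idempotent_monoid ?Q"
    using idempotent_monoid_image[OF _ epi] idempotent_kl_action by (metis C_cell_def)
qed


lemma up_closed_identified:
  fixes A :: "point set"
  shows "A \<in> {{X, Y}, {X}} \<Longrightarrow> A \<union> B \<in> {{X, Y}, {X}}"
    "A \<in> {{X, Y}, {Y}} \<Longrightarrow> A \<union> B \<in> {{X, Y}, {Y}}"
    "A \<in> {{X, Y}, {X}, {Y}} \<Longrightarrow> A \<union> B \<in> {{X, Y}, {X}, {Y}}"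
  by (cases A rule: point_set_cases; cases B rule: point_set_cases; auto)+

lemma minimal_proper_N:
  "minimal_proper_semimodule R (N1 n)" "minimal_proper_semimodule R (N2 n)"
  "minimal_proper_semimodule R (N3 n)"
  unfolding N1_def N2_def N3_def
  by (rule minimal_proper_identify; use up_closed_identified in blast)+

section \<open>The classification\<close>

text \<open>
  A map from a semilattice with an action of the basis to a minimal semimodule only has to be
  checked on the basis, and is onto as soon as it is not zero.
\<close>

lemma kl_action_epi:
  fixes act :: "letter list set \<Rightarrow> 'b::bounded_semilattice_sup_bot \<Rightarrow> 'b"
  assumes M: "minimal_semimodule R M" and h: "\<And>x. h x \<in> carrier M" "h bot = \<zero>\<^bsub>M\<^esub>"
      "\<And>x y. h (sup x y) = h x \<oplus>\<^bsub>M\<^esub> h y"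
    and act: "\<And>w x. w \<in> carrier (dihedral n) \<Longrightarrow> h (act w x) = kl n w \<odot>\<^bsub>M\<^esub> h x"
    and nonzero: "h y \<noteq> \<zero>\<^bsub>M\<^esub>"
  shows "h \<in> semimodule_epi R (kl_action_semimodule n act) M"
proof -
  interpret M: semimodule R M using M by (simp add: minimal_semimodule_def)
  note sm = kl_action_smult[where act = act]
  have smult: "h (r \<odot>\<^bsub>kl_action_semimodule n act\<^esub> x) = r \<odot>\<^bsub>M\<^esub> h x" if "r \<in> carrier R" for r x
    using that by (induction rule: R_induct) (simp_all add: sm h act M.smult_l_null M.smult_l_distr)
  have "range h = {\<zero>\<^bsub>M\<^esub>} \<or> range h = carrier M"
  proof (rule M.minimal_subsemimodule[OF M])
    show "\<zero>\<^bsub>M\<^esub> \<in> range h" using h(2) by (metis rangeI)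
    show "u \<oplus>\<^bsub>M\<^esub> v \<in> range h" if "u \<in> range h" "v \<in> range h" for u v
      using that by (auto simp: h(3)[symmetric])
    show "a \<odot>\<^bsub>M\<^esub> u \<in> range h" if "a \<in> carrier R" "u \<in> range h" for a u
      using that by (auto simp: smult[symmetric])
  qed (use h(1) in auto)
  then have "range h = carrier M" using nonzero by blast
  then show ?thesis
    by (simp add: semimodule_epi_def kl_action_simps h smult)
qed

lemma id_epi: "id \<in> semimodule_epi R M M"
  by (simp add: semimodule_epi_def)

lemma semimodule_isomorphic_if_inj:
  assumes "semimodule R N" "h \<in> semimodule_epi R N M" "inj_on h (carrier N)"
  shows "semimodule_isomorphic R M N"
  by (rule semimodule_isomorphic_same_fibres[OF assms(1,2) id_epi])
    (use assms(3) in \<open>auto simp: inj_on_def\<close>)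

lemma semimodule_isomorphic_quotient_C_cell:
  assumes h: "h \<in> semimodule_epi R (C_cell n) M"
    and K: "\<And>A. A \<in> K \<Longrightarrow> A \<noteq> {}" "\<And>A B. A \<in> K \<Longrightarrow> A \<union> B \<in> K"
    and fib: "\<And>A B. h A = h B \<longleftrightarrow> A = B \<or> A \<in> K \<and> B \<in> K"
  shows "semimodule_isomorphic R M (quotient_semimodule (C_cell n) (identify (C_cell n) K))"
proof (rule semimodule_isomorphic_same_fibres[OF semimodule_C_cell h identify_epi[OF K]])
  have cls: "identify (C_cell n) K `` {A} = {A} \<union> (if A \<in> K then K else {})" for A
    by (auto simp: identify_def C_cell_simps)
  fix A B
  show "h A = h B \<longleftrightarrow> identify (C_cell n) K `` {A} = identify (C_cell n) K `` {B}"
    unfolding fib cls by (cases "A \<in> K"; cases "B \<in> K") (auto simp: insert_absorb)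
qed auto


primrec C_sum :: "letter \<Rightarrow> nat \<Rightarrow> letter list set \<Rightarrow> int" where
  "C_sum a 0 = \<zero>\<^bsub>R\<^esub>"
| "C_sum a (Suc j) = C_sum a j \<oplus>\<^bsub>R\<^esub> C a (Suc j)"

lemma C_sum_closed [simp]: "C_sum a j \<in> carrier R"
  by (induction j) auto

end

locale minimal_proper_kl = kl_dihedral +
  fixes M :: "(letter list set \<Rightarrow> int, 'm) module" (structure)
  assumes minimal_proper: "minimal_proper_semimodule (kl_semiring n) M"
begin

lemma minimal: "minimal_semimodule R M"
  using minimal_proper by (simp add: minimal_proper_semimodule_def)

sublocale semimodule "kl_semiring n" M
  using minimal by (simp add: minimal_semimodule_def)

lemma exists_nonzero: "\<exists>m\<in>carrier M. m \<noteq> \<zero>"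
  using minimal M.zero_closed by (auto simp: minimal_semimodule_def)

text \<open>The orbit of a non-zero element under the finite basis generates the module additively.\<close>

lemma idempotent: "x \<in> carrier M \<Longrightarrow> x \<oplus> x = x"
proof -
  obtain m where m: "m \<in> carrier M" "m \<noteq> \<zero>" using exists_nonzero by blast
  let ?G = "(\<lambda>w. kl n w \<odot> m) ` carrier (dihedral n)"
  have G: "?G \<subseteq> carrier M" using m by auto
  have hull: "r \<odot> m \<in> add_hull M ?G" if "r \<in> carrier R" for r
    using that m(1)
    by (induction rule: R_induct)
      (auto simp: smult_l_null smult_l_distr intro: add_hull.intros)
  let ?H = "(\<lambda>r. r \<odot> m) ` carrier R"
  have "?H = {\<zero>} \<or> ?H = carrier M"
  proof (rule minimal_subsemimodule[OF minimal])
    show "\<zero> \<in> ?H" using smult_l_null[OF m(1)] R.zero_closed by (metis imageI)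
    show "x \<oplus> y \<in> ?H" if "x \<in> ?H" "y \<in> ?H" for x y
      using that m(1) by (auto simp: smult_l_distr[symmetric])
    show "a \<odot> x \<in> ?H" if "a \<in> carrier R" "x \<in> ?H" for a x
      using that m(1) by (auto simp: smult_assoc[symmetric])
  qed (use m in auto)
  moreover have "m \<in> ?H" using smult_one[OF m(1)] R.one_closed by (metis imageI)
  ultimately have H: "?H = carrier M" using m(2) by blast
  have "add_hull M ?G = carrier M"
  proof (intro equalityI subsetI)
    fix x assume "x \<in> carrier M"
    then have "x \<in> ?H" by (simp only: H)
    then show "x \<in> add_hull M ?G" using hull by blast
  qed (rule add_hull_closed[OF G])
  then have "idempotent_monoid M"
    using minimal_proper_idempotent[OF minimal_proper _ G] finite_D by blast
  then show "x \<oplus> x = x" if "x \<in> carrier M" using that by (simp add: idempotent_monoid_def)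
qed

lemma absorb:
  assumes "x \<in> carrier M" "y \<in> carrier M"
  shows "x \<oplus> y \<oplus> x = x \<oplus> y" "x \<oplus> y \<oplus> y = x \<oplus> y"
proof -
  have "x \<oplus> y \<oplus> x = (x \<oplus> x) \<oplus> y" using assms by (simp add: M.a_ac)
  then show "x \<oplus> y \<oplus> x = x \<oplus> y" using assms by (simp add: idempotent)
  show "x \<oplus> y \<oplus> y = x \<oplus> y" using assms by (simp add: M.a_assoc idempotent)
qed

lemma zerosumfree: "x \<in> carrier M \<Longrightarrow> y \<in> carrier M \<Longrightarrow> x \<oplus> y = \<zero> \<Longrightarrow> x = \<zero>"
  by (rule minimal_proper_zerosumfree[OF minimal_proper])

text \<open>If every basis element fixes or kills \<open>g\<close>, then \<open>{0, g}\<close> is a subsemimodule, hence all of \<open>M\<close>.\<close>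

lemma two_element_epi:
  assumes g: "g \<in> carrier M" "g \<noteq> \<zero>"
    and act: "\<And>w. w \<in> carrier (dihedral n) \<Longrightarrow> kl n w \<odot> g = (if act w True then g else \<zero>)"
      "\<And>w. w \<in> carrier (dihedral n) \<Longrightarrow> \<not> act w False"
  shows "\<exists>h\<in>semimodule_epi R (kl_action_semimodule n act) M. inj h"
proof -
  define h where "h b = (if b then g else \<zero>)" for b
  have "h \<in> semimodule_epi R (kl_action_semimodule n act) M"
  proof (rule kl_action_epi[OF minimal, of h _ True])
    show "h (act w x) = kl n w \<odot> h x" if "w \<in> carrier (dihedral n)" for w x
      using act[OF that] that by (cases x) (auto simp: h_def smult_r_null)
  qed (use g in \<open>auto simp: h_def idempotent\<close>)
  moreover have "inj h" using g by (auto simp: inj_def h_def)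
  ultimately show ?thesis by blast
qed

text \<open>
  A basis element multiplies the longest one by a positive integer, so it fixes \<open>C S n \<odot> m\<close>.
\<close>

lemma isomorphic_C_w0:
  assumes m: "m \<in> carrier M" "C S n \<odot> m \<noteq> \<zero>"
  shows "semimodule_isomorphic R M (C_w0 n)"
proof -
  let ?g = "C S n \<odot> m"
  have g: "?g \<in> carrier M" using m by simp
  have multiple: "(\<lambda>x. 2 * int k * C S n x) \<odot> m = ?g" if "0 < k" for k
    using additive_multiple_C_n[of "\<lambda>r. r \<odot> m" "add M" S "2 * k"] that m(1) idempotent[OF g]
    by (simp add: smult_l_distr)
  have "kl n w \<odot> ?g = ?g" if "w \<in> carrier (dihedral n)" for w
    using that
    by (cases rule: kl_cases)
      (use m(1) n_pos multiple in \<open>simp_all add: smult_one smult_assoc[symmetric] C_mult_C_n\<close>)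
  then have "\<exists>h\<in>semimodule_epi R (C_w0 n) M. inj h"
    unfolding C_w0_def by (intro two_element_epi[OF g m(2)]) auto
  then show ?thesis
    using semimodule_isomorphic_if_inj[OF semimodule_C_w0] inj_on_subset by blast
qed

context
  assumes longest_zero: "\<And>m. m \<in> carrier M \<Longrightarrow> C S n \<odot> m = \<zero>"
begin

lemma C_n_zero: "m \<in> carrier M \<Longrightarrow> C a n \<odot> m = \<zero>"
  using longest_zero C_n[of a S] by simp

text \<open>The generator at the right end of \<open>C a k\<close> can be split off, as doubling is invisible in \<open>M\<close>.\<close>

lemma isomorphic_C_e:
  assumes m: "m \<in> carrier M" "m \<noteq> \<zero>" "\<And>a. C a 1 \<odot> m = \<zero>"
  shows "semimodule_isomorphic R M (C_e n)"
proof -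
  have zero: "C a k \<odot> m = \<zero>" if "k < n" for a k
  proof -
    have "C a k \<odot> m = C a k \<odot> m \<oplus> C a k \<odot> m" using m(1) by (simp add: idempotent)
    also have "\<dots> = C a k \<odot> (C (other_end a k) 1 \<odot> m)"
      using m(1) generator_mult_right(1)[of k a] that
      by (simp add: smult_assoc[symmetric] smult_l_distr)
    also have "\<dots> = \<zero>" using m(3) by (simp add: smult_r_null)
    finally show ?thesis .
  qed
  have "kl n w \<odot> m = (if w = \<one>\<^bsub>dihedral n\<^esub> then m else \<zero>)" if "w \<in> carrier (dihedral n)" for w
    using that
    by (cases rule: kl_cases)
      (use m(1) zero C_n_zero one_neq_longest wd_mid_neq in \<open>auto simp: smult_one\<close>)
  then have "\<exists>h\<in>semimodule_epi R (C_e n) M. inj h"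
    unfolding C_e_def by (intro two_element_epi[OF m(1,2)]) auto
  then show ?thesis
    using semimodule_isomorphic_if_inj[OF semimodule_C_e] inj_on_subset by blast
qed

lemma C_sum_absorbs:
  assumes "m \<in> carrier M" "k \<le> j"
  shows "C_sum a j \<odot> m \<oplus> C a k \<odot> m = C_sum a j \<odot> m"
  using assms(2)
proof (induction j)
  case 0
  then show ?case using assms(1) by (simp add: smult_l_null)
next
  case (Suc j)
  have "C_sum a j \<odot> m \<oplus> C a (Suc j) \<odot> m \<oplus> C a k \<odot> m =
      (C_sum a j \<odot> m \<oplus> C a k \<odot> m) \<oplus> C a (Suc j) \<odot> m"
    using assms(1) by (simp add: M.a_ac)
  then show ?case
    using Suc assms(1) by (cases "k = Suc j")
      (simp_all add: smult_l_distr M.a_assoc idempotent)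
qed

lemma generator_C_sum_same:
  assumes m: "m \<in> carrier M" and "j < n"
  shows "C a 1 \<odot> (C_sum a j \<odot> m) = C_sum a j \<odot> m"
  using assms(2)
proof (induction j)
  case 0
  then show ?case using m by (simp add: smult_l_null smult_r_null)
next
  case (Suc j)
  have "C a 1 \<odot> (C a (Suc j) \<odot> m) = C a (Suc j) \<odot> m"
    using m Suc.prems generator_mult_left(1)[of "Suc j" a]
    by (simp add: smult_assoc[symmetric] smult_l_distr idempotent)
  then show ?case using Suc m by (simp add: smult_l_distr smult_r_distr)
qed

text \<open>
  The generator shifts the summation range by one in both directions, and idempotency merges the two
  copies. There have to be at least two summands: the first one only contributes \<open>C a 2\<close>, and it
  takes the second one to produce \<open>C a 1\<close>.
\<close>

lemma generator_C_sum_flip: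
  assumes m: "m \<in> carrier M" and "Suc (Suc j) < n"
  shows "C a 1 \<odot> (C_sum (flip a) (Suc (Suc j)) \<odot> m) = C_sum a (Suc (Suc (Suc j))) \<odot> m"
proof -
  have step: "C a 1 \<odot> (C (flip a) (Suc k) \<odot> m) = C a (Suc (Suc k)) \<odot> m \<oplus> C a k \<odot> m"
    if "Suc k < n" for k
    using that m generator_mult_left(2)[of "Suc k" a]
    by (simp add: smult_assoc[symmetric] smult_l_distr)
  show ?thesis using assms(2)
  proof (induction j)
    case 0
    then show ?case
      using m step[of 0] step[of "Suc 0"]
      by (simp add: smult_l_distr smult_r_distr smult_l_null smult_r_null M.a_ac)
  next
    case (Suc j)
    have "C a 1 \<odot> (C_sum (flip a) (Suc (Suc (Suc j))) \<odot> m) =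
        C_sum a (Suc (Suc (Suc j))) \<odot> m \<oplus> C a 1 \<odot> (C (flip a) (Suc (Suc (Suc j))) \<odot> m)"
      using Suc m by (simp only: C_sum.simps(2)[of "flip a" "Suc (Suc j)"]
          smult_l_distr smult_r_distr C_sum_closed C_closed smult_closed Suc_lessD)
    also have "\<dots> = C_sum a (Suc (Suc (Suc j))) \<odot> m \<oplus>
        (C a (Suc (Suc (Suc (Suc j)))) \<odot> m \<oplus> C a (Suc (Suc j)) \<odot> m)"
      using step[of "Suc (Suc j)"] Suc.prems by simp
    also have "\<dots> = (C_sum a (Suc (Suc (Suc j))) \<odot> m \<oplus> C a (Suc (Suc j)) \<odot> m) \<oplus>
        C a (Suc (Suc (Suc (Suc j)))) \<odot> m"
      using m by (simp add: M.a_ac del: C_sum.simps)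
    also have "\<dots> = C_sum a (Suc (Suc (Suc j))) \<odot> m \<oplus> C a (Suc (Suc (Suc (Suc j)))) \<odot> m"
      using m C_sum_absorbs[OF m, of "Suc (Suc j)" "Suc (Suc (Suc j))" a] by (simp del: C_sum.simps)
    also have "\<dots> = C_sum a (Suc (Suc (Suc (Suc j)))) \<odot> m"
      using m by (simp only: C_sum.simps(2)[of a "Suc (Suc (Suc j))"] smult_l_distr C_sum_closed C_closed)
    finally show ?case .
  qed
qed

text \<open>
  For the whole cell the term that leaves the range at the top is \<open>C a n\<close>, which acts as zero. The
  two summands required for the other letter exist because \<open>n \<ge> 3\<close>.
\<close>

lemma generator_C_sum:
  assumes m: "m \<in> carrier M"
  shows "C a 1 \<odot> (C_sum b (n - 1) \<odot> m) = C_sum a (n - 1) \<odot> m"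
proof (cases "a = b")
  case True
  then show ?thesis using generator_C_sum_same[OF m] n_pos by simp
next
  case False
  have n: "Suc (Suc (n - 3)) = n - 1" "Suc (n - 1) = n" using n_ge_3 by simp_all
  have "C_sum a n = C_sum a (n - 1) \<oplus>\<^bsub>R\<^esub> C a n"
    using C_sum.simps(2)[of a "n - 1"] unfolding n .
  then have "C_sum a n \<odot> m = C_sum a (n - 1) \<odot> m"
    using m by (simp add: smult_l_distr C_n_zero)
  then show ?thesis
    using generator_C_sum_flip[OF m, of "n - 3" a, unfolded n] False n_pos by (simp add: neq_iff_flip)
qed

text \<open>
  The right product formulas show that \<open>C a k\<close> acts in the same way on \<open>p S\<close> and \<open>p T\<close> and that its
  value is the sum of those of \<open>C a (k - 1)\<close> and \<open>C a (k + 1)\<close>. So neighbouring values dominate each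
  other in the join order, and they are equal.
\<close>

lemma C_act_pair:
  assumes p: "\<And>a. p a \<in> carrier M" "\<And>a b. C a 1 \<odot> p b = p a" and k: "0 < k" "k < n"
  shows "C a k \<odot> p b = p a"
proof -
  have same: "C a k \<odot> p b = C a k \<odot> p c" if k: "0 < k" "k < n" for k b c
  proof -
    let ?o = "other_end a k"
    have "C a k \<odot> p ?o = C a k \<odot> p (flip ?o)"
    proof -
      have "C a k \<odot> p ?o = C a k \<odot> (C ?o 1 \<odot> p (flip ?o))" by (simp add: p(2))
      also have "\<dots> = C a k \<odot> p (flip ?o) \<oplus> C a k \<odot> p (flip ?o)"
        using generator_mult_right(1)[of k a] k p(1) by (simp add: smult_assoc[symmetric] smult_l_distr)
      finally show ?thesis using p(1) by (simp add: idempotent)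
    qed
    then show ?thesis
      using neq_iff_flip[of ?o b] neq_iff_flip[of ?o c] by (cases "?o = b"; cases "?o = c") auto
  qed
  \<comment> \<open>\<open>F 0 = F n = \<zero>\<close>, so the recursion below also holds next to the ends of the range.\<close>
  define F where "F k = C a k \<odot> p a" for k
  have F: "F k \<in> carrier M" for k by (simp add: F_def p(1))
  have rec: "F k = F (Suc k) \<oplus> F (k - 1)" if k: "0 < k" "k < n" for k
  proof -
    let ?o = "other_end a k"
    have other: "C a j \<odot> p ?o = F j" if "j \<le> n" for j
      using same[of j ?o a] that C_n_zero p(1)
      by (cases "j = 0 \<or> j = n") (auto simp: F_def smult_l_null)
    have "F k = C a k \<odot> (C (flip ?o) 1 \<odot> p ?o)"
      using same[OF k] by (simp add: p(2) F_def)
    also have "\<dots> = C a (Suc k) \<odot> p ?o \<oplus> C a (k - 1) \<odot> p ?o"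
      using generator_mult_right(2)[of k a] k p(1) by (simp add: smult_assoc[symmetric] smult_l_distr)
    also have "\<dots> = F (Suc k) \<oplus> F (k - 1)" using other k by simp
    finally show ?thesis .
  qed
  have step: "F (Suc k) = F k" if "0 < k" "Suc k < n" for k
  proof -
    have "F k \<oplus> F (Suc k) = F k"
      using absorb(1)[OF F F, of "Suc k" "k - 1"] rec[of k] that by simp
    moreover have "F (Suc k) \<oplus> F k = F (Suc k)"
      using absorb(2)[OF F F, of "Suc (Suc k)" k] rec[of "Suc k"] that by simp
    ultimately show ?thesis using M.a_comm[OF F F, of k "Suc k"] by simp
  qed
  have "F k = F 1" if "0 < k" "k < n" for k
    using that
  proof (induction k)
    case (Suc k)
    then show ?case using step[of k] by (cases "k = 0") (auto simp: One_nat_def)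
  qed simp
  then have "C a k \<odot> p a = p a" using k p(2) by (simp add: F_def)
  then show ?thesis using same[OF k] by metis
qed

text \<open>
  The two cell sums span the image of the four-element semimodule. They are not zero: otherwise both
  would be, since the generators map each one to the other, and a sum vanishes only if its terms do.
\<close>

lemma isomorphic_cell:
  assumes faithful: "\<And>m. m \<in> carrier M \<Longrightarrow> m \<noteq> \<zero> \<Longrightarrow> \<exists>a. C a 1 \<odot> m \<noteq> \<zero>"
  shows "semimodule_isomorphic R M (C_cell n) \<or> semimodule_isomorphic R M (N1 n) \<or>
    semimodule_isomorphic R M (N2 n) \<or> semimodule_isomorphic R M (N3 n)"
proof -
  obtain m where m: "m \<in> carrier M" "m \<noteq> \<zero>" using exists_nonzero by blast
  define p where "p a = C_sum a (n - 1) \<odot> m" for a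
  have p: "p a \<in> carrier M" for a using m(1) by (simp add: p_def)
  have gen: "C a 1 \<odot> p b = p a" for a b using generator_C_sum[OF m(1)] by (simp add: p_def)
  have p_nonzero: "p a \<noteq> \<zero>" for a
  proof
    assume a: "p a = \<zero>"
    have zero: "p b = \<zero>" for b using gen[of b a] a by (simp add: smult_r_null)
    obtain b where b: "C b 1 \<odot> m \<noteq> \<zero>" using faithful[OF m] by blast
    have "p b \<oplus> C b 1 \<odot> m = p b" using C_sum_absorbs[OF m(1), of 1 "n - 1" b] n_ge_3 by (simp add: p_def)
    then show False using zero b m(1) by simp
  qed
  have C_p: "C a k \<odot> p b = p a" if "0 < k" "k < n" for a b k
    using C_act_pair[OF p gen that] .
  define h where "h A = (if X \<in> A then p S else \<zero>) \<oplus> (if Y \<in> A then p T else \<zero>)" for A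
  have h_simps: "h {} = \<zero>" "h {X} = p S" "h {Y} = p T" "h {X, Y} = p S \<oplus> p T" "h {Y, X} = p S \<oplus> p T"
    using p by (auto simp: h_def)
  have h_closed: "h A \<in> carrier M" for A using p by (auto simp: h_def)
  have h_Un: "h (A \<union> B) = h A \<oplus> h B" for A B
  proof -
    have "p S \<oplus> (p S \<oplus> p T) = p S \<oplus> p T"
      using p by (simp add: M.a_assoc[symmetric] idempotent)
    then show ?thesis
      using p by (cases A rule: point_set_cases; cases B rule: point_set_cases)
        (auto simp: h_def M.a_ac idempotent)
  qed
  have h_point: "h {cell_point a} = p a" for a
    by (cases a) (simp_all add: cell_point_def h_simps)
  have "kl n w \<odot> h A = h (\<Union>q\<in>A. C_cell_act n w q)" if w: "w \<in> carrier (dihedral n)" for w A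
    using w
  proof (cases rule: kl_cases)
    case 1
    then show ?thesis using h_closed by (simp add: C_cell_act_simps smult_one)
  next
    case (2 a k)
    have "C a k \<odot> h A = (if A = {} then \<zero> else p a)"
      using p C_p[OF 2(1,2)]
      by (cases A rule: point_set_cases) (simp_all add: h_simps smult_r_null smult_r_distr idempotent)
    then show ?thesis using 2 by (simp add: C_cell_act_simps h_point h_simps)
  next
    case 3
    then show ?thesis using longest_zero h_closed by (simp add: C_cell_act_simps h_simps)
  qed
  then have epi: "h \<in> semimodule_epi R (C_cell n) M"
    unfolding C_cell_def
    by (intro kl_action_epi[OF minimal, of h _ "{X}"])
      (use h_closed h_simps h_Un p_nonzero in auto)
  have sum_nonzero: "p S \<oplus> p T \<noteq> \<zero>" using zerosumfree p p_nonzero by blast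
  note nz = p_nonzero p_nonzero[symmetric] sum_nonzero sum_nonzero[symmetric]
  note iso = semimodule_isomorphic_quotient_C_cell[OF epi]
  consider (C) "p S \<noteq> p T" "p S \<oplus> p T \<noteq> p S" "p S \<oplus> p T \<noteq> p T"
    | (N1) "p S \<noteq> p T" "p S \<oplus> p T = p S" | (N2) "p S \<noteq> p T" "p S \<oplus> p T = p T"
    | (N3) "p S = p T"
    by blast
  then show ?thesis
  proof cases
    case C
    have "inj h"
    proof (rule injI)
      fix A B assume "h A = h B"
      then show "A = B"
        using C nz by (cases A rule: point_set_cases; cases B rule: point_set_cases) (auto simp: h_simps)
    qed
    then show ?thesis
      using semimodule_isomorphic_if_inj[OF semimodule_C_cell epi] inj_on_subset by blast
  next
    case N1
    have "semimodule_isomorphic R M (N1 n)" unfolding N1_def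
    proof (rule iso)
      show "h A = h B \<longleftrightarrow> A = B \<or> A \<in> {{X, Y}, {X}} \<and> B \<in> {{X, Y}, {X}}" for A B
        using N1 nz by (cases A rule: point_set_cases; cases B rule: point_set_cases) (auto simp: h_simps)
    qed (use up_closed_identified in blast)+
    then show ?thesis by blast
  next
    case N2
    have "semimodule_isomorphic R M (N2 n)" unfolding N2_def
    proof (rule iso)
      show "h A = h B \<longleftrightarrow> A = B \<or> A \<in> {{X, Y}, {Y}} \<and> B \<in> {{X, Y}, {Y}}" for A B
        using N2 nz by (cases A rule: point_set_cases; cases B rule: point_set_cases) (auto simp: h_simps)
    qed (use up_closed_identified in blast)+
    then show ?thesis by blast
  next
    case N3
    have "semimodule_isomorphic R M (N3 n)" unfolding N3_def
    proof (rule iso)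
      show "h A = h B \<longleftrightarrow> A = B \<or> A \<in> {{X, Y}, {X}, {Y}} \<and> B \<in> {{X, Y}, {X}, {Y}}" for A B
        using N3 nz p idempotent
        by (cases A rule: point_set_cases; cases B rule: point_set_cases) (auto simp: h_simps)
    qed (use up_closed_identified in blast)+
    then show ?thesis by blast
  qed
qed

end

lemma classification:
  "semimodule_isomorphic R M (C_e n) \<or> semimodule_isomorphic R M (C_w0 n) \<or>
    semimodule_isomorphic R M (C_cell n) \<or> semimodule_isomorphic R M (N1 n) \<or>
    semimodule_isomorphic R M (N2 n) \<or> semimodule_isomorphic R M (N3 n)"
  using isomorphic_C_w0 isomorphic_C_e isomorphic_cell by blast

end

theorem corollary10p2:
  fixes n :: nat and M :: "(letter list set \<Rightarrow> int, 'm) module"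
  assumes "n \<ge> 3"
  shows "minimal_proper_semimodule (kl_semiring n) (C_e n) \<and>
    minimal_proper_semimodule (kl_semiring n) (C_w0 n) \<and>
    minimal_proper_semimodule (kl_semiring n) (C_cell n) \<and>
    minimal_proper_semimodule (kl_semiring n) (N1 n) \<and>
    minimal_proper_semimodule (kl_semiring n) (N2 n) \<and>
    minimal_proper_semimodule (kl_semiring n) (N3 n) \<and>
    (minimal_proper_semimodule (kl_semiring n) M \<longrightarrow>
      semimodule_isomorphic (kl_semiring n) M (C_e n) \<or>
      semimodule_isomorphic (kl_semiring n) M (C_w0 n) \<or>
      semimodule_isomorphic (kl_semiring n) M (C_cell n) \<or>
      semimodule_isomorphic (kl_semiring n) M (N1 n) \<or>
      semimodule_isomorphic (kl_semiring n) M (N2 n) \<or>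
      semimodule_isomorphic (kl_semiring n) M (N3 n))"
proof -
  interpret kl_dihedral n using assms by unfold_locales
  have "minimal_proper_kl n M" if "minimal_proper_semimodule (kl_semiring n) M"
    using that by unfold_locales
  then show ?thesis
    using minimal_proper_C_e minimal_proper_C_w0 minimal_proper_C_cell minimal_proper_N
      minimal_proper_kl.classification by blast
qed

end
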